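(* Let $d\in\mathbb{N}$, $\alpha\in(0,2)$, $m\ge 0$, $a,v>0$, and let $\varphi_0$ be the ground state of $H_{m,\alpha}=L_{m,\alpha}-v\mathbf{1}_{\mathcal{B}_a}$ (assumed to exist). The following hold: (1) If $\alpha\in(0,1)$, then $\varphi_0\notin C^{\alpha+\delta}_{\rm loc}(\mathbb{R}^d)$ for every $\delta\in(0,1-\alpha)$. (2) If $\alpha\in[1,2)$, then $\varphi_0\notin C^{1,\alpha+\delta-1}_{\rm loc}(\mathbb{R}^d)$ for every $\delta\in(0,2-\alpha)$.
   Context: For $z\ge 0$ let $\Phi_{m,\alpha}(z)=(z+m^{2/\alpha})^{\alpha/2}-m$, and let $L_{m,\alpha}=\Phi_{m,\alpha}(-\Delta)$ be the self-adjoint operator on $L^2(\mathbb{R}^d)$ given by the Fourier multiplier $\Phi_{m,\alpha}(|y|^2)$. $\mathcal{B}_a$ is the open ball of radius $a$ centred at $0$. A ground state of $H_{m,\alpha}$ is a nonzero $\varphi_0\in\mathrm{Dom}(H_{m,\alpha})$ with $H_{m,\alpha}\varphi_0=\lambda_0\varphi_0$, where $\lambda_0=\inf\mathrm{Spec}\,H_{m,\alpha}\in(-v,0)$. If it exists it is unique up to a scalar multiple, bounded and continuous, and it is always chosen strictly positive with $\|\varphi_0\|_{L^2}=1$. For $\gamma\in(0,1)$, $C^{\gamma}_{\rm loc}(\mathbb{R}^d)$ is the space of functions that are H\"older continuous with exponent $\gamma$ on every compact set, and $C^{1,\gamma}_{\rm loc}(\mathbb{R}^d)$ the space of $C^1$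 functions whose gradient is H\"older continuous with exponent $\gamma$ on every compact set. *)

theory Defs
  imports "HOL-Analysis.Analysis"
begin

text \<open>
  Elements of the complex Hilbert space \<open>L\<^sup>2(\<real>\<^sup>d)\<close> are represented by Borel functions; equality in
  \<open>L\<^sup>2\<close> is equality almost everywhere with respect to Lebesgue measure.
\<close>

definition L2_space :: "('a::euclidean_space \<Rightarrow> complex) set" where
  "L2_space = {f. f \<in> borel_measurable lborel \<and> integrable lborel (\<lambda>x. (norm (f x))\<^sup>2)}"

definition L2_norm :: "('a::euclidean_space \<Rightarrow> complex) \<Rightarrow> real" where
  "L2_norm f = sqrt (\<integral>x. (norm (f x))\<^sup>2 \<partial>lborel)"

definition fourier_L1 :: "('a::euclidean_space \<Rightarrow> complex) \<Rightarrow> 'a \<Rightarrow> complex" where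
  "fourier_L1 f y =
     of_real ((2 * pi) powr (- real DIM('a) / 2)) * (\<integral>x. cis (- (x \<bullet> y)) * f x \<partial>lborel)"

text \<open>
  The Fourier--Plancherel transform as a relation between representatives: \<open>F\<close> is the \<open>L\<^sup>2\<close>-limit
  of the Fourier integrals of the truncations of \<open>f\<close> to balls, which lie in \<open>L\<^sup>1 \<inter> L\<^sup>2\<close>.  With this
  normalisation (no \<open>2\<pi>\<close> in the exponent) \<open>-\<Delta>\<close> corresponds to multiplication by \<open>|y|\<^sup>2\<close>.
\<close>

definition plancherel :: "('a::euclidean_space \<Rightarrow> complex) \<Rightarrow> ('a \<Rightarrow> complex) \<Rightarrow> bool" where
  "plancherel f F \<longleftrightarrow> f \<in> L2_space \<and> F \<in> L2_space \<and>
     (\<lambda>n. \<integral>\<^sup>+y. ennreal ((norm (fourier_L1 (\<lambda>x. indicator (ball 0 (real n)) x * f x) y - F y))\<^sup>2) \<partial>lborel)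
       \<longlonglongrightarrow> 0"

text \<open>
  Unbounded operators on \<open>L\<^sup>2(\<real>\<^sup>d)\<close> are given by their graphs, which are closed under almost everywhere
  modification of either component.  A Fourier multiplier has its maximal domain, the
  \<open>f \<in> L\<^sup>2\<close> for which \<open>\<mu>\<close> times the transform of \<open>f\<close> is in \<open>L\<^sup>2\<close>.
\<close>

type_synonym 'a L2_op = "(('a \<Rightarrow> complex) \<times> ('a \<Rightarrow> complex)) set"

definition fourier_multiplier :: "('a::euclidean_space \<Rightarrow> real) \<Rightarrow> 'a L2_op" where
  "fourier_multiplier \<mu> =
     {(f, h). \<exists>F G. plancherel f F \<and> plancherel h G \<and> (AE y in lborel. G y = of_real (\<mu> y) * F y)}"

definition add_potential :: "'a::euclidean_space L2_op \<Rightarrow> ('a \<Rightarrow> real) \<Rightarrow> 'a L2_op" where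
  "add_potential T V =
     {(f, h). h \<in> L2_space \<and> (\<exists>g. (f, g) \<in> T \<and> (AE x in lborel. h x = g x + of_real (V x) * f x))}"

text \<open>
  \<open>z\<close> is in the resolvent set if \<open>T - z\<close> maps its domain onto \<open>L\<^sup>2\<close> with a bounded inverse; the norm
  bound includes injectivity.
\<close>

definition resolvent_set :: "'a::euclidean_space L2_op \<Rightarrow> complex set" where
  "resolvent_set T = {z.
     (\<forall>g\<in>L2_space. \<exists>(f, h)\<in>T. AE x in lborel. h x - z * f x = g x) \<and>
     (\<exists>C. \<forall>(f, h)\<in>T. L2_norm f \<le> C * L2_norm (\<lambda>x. h x - z * f x))}"

definition spectrum :: "'a::euclidean_space L2_op \<Rightarrow> complex set" where
  "spectrum T = - resolvent_set T"

text \<open>For self-adjoint operators the spectrum is real, so that no spectral points are ignored here.\<close>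

definition spectral_bottom :: "'a::euclidean_space L2_op \<Rightarrow> real" where
  "spectral_bottom T = Inf {t. complex_of_real t \<in> spectrum T}"

definition Phi :: "real \<Rightarrow> real \<Rightarrow> real \<Rightarrow> real" where
  "Phi m \<alpha> z = (z + m powr (2 / \<alpha>)) powr (\<alpha> / 2) - m"

definition L_op :: "real \<Rightarrow> real \<Rightarrow> 'a::euclidean_space L2_op" where
  "L_op m \<alpha> = fourier_multiplier (\<lambda>y. Phi m \<alpha> ((norm y)\<^sup>2))"

definition H_op :: "real \<Rightarrow> real \<Rightarrow> real \<Rightarrow> real \<Rightarrow> 'a::euclidean_space L2_op" where
  "H_op m \<alpha> a v = add_potential (L_op m \<alpha>) (\<lambda>x. - v * indicator (ball 0 a) x)"

definition ground_state ::
  "real \<Rightarrow> real \<Rightarrow> real \<Rightarrow> real \<Rightarrow> ('a::euclidean_space \<Rightarrow> complex) \<Rightarrow> bool" where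
  "ground_state m \<alpha> a v \<phi> \<longleftrightarrow>
     (let E\<^sub>0 = spectral_bottom (H_op m \<alpha> a v :: 'a L2_op) in
        - v < E\<^sub>0 \<and> E\<^sub>0 < 0 \<and>
        \<not> (AE x in lborel. \<phi> x = 0) \<and>
        (\<phi>, \<lambda>x. of_real E\<^sub>0 * \<phi> x) \<in> H_op m \<alpha> a v)"

definition Holder_loc :: "real \<Rightarrow> ('a::euclidean_space \<Rightarrow> 'b::real_normed_vector) set" where
  "Holder_loc \<gamma> =
     {f. \<forall>K. compact K \<longrightarrow> (\<exists>C. \<forall>x\<in>K. \<forall>y\<in>K. norm (f x - f y) \<le> C * norm (x - y) powr \<gamma>)}"

definition C1_Holder_loc :: "real \<Rightarrow> ('a::euclidean_space \<Rightarrow> real) set" where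
  "C1_Holder_loc \<gamma> =
     {f. \<exists>g. (\<forall>x. GDERIV f x :> g x) \<and> continuous_on UNIV g \<and> g \<in> Holder_loc \<gamma>}"

end

theory Submission
  imports Defs "HOL-Probability.Characteristic_Functions" "HOL-Real_Asymp.Real_Asymp"
begin

text \<open>
  By the eigenvalue equation \<open>L \<phi> = (E + v 1\<^sub>B) \<phi>\<close>, the function \<open>L \<phi>\<close> jumps across the sphere of
  radius \<open>a\<close>, because \<open>\<phi> > 0\<close> there.  Test this equation at a boundary point \<open>p\<close> against the normal
  derivative of the heat kernel of variance \<open>r\<close>.  The jump contributes at least a multiple of
  \<open>r\<close> to the power \<open>- 1 / 2\<close>.  On the Fourier side the test function is a polynomial times a Gaussian, and
  subordination turns \<open>L\<close> into an integral over \<open>t\<close>, with weight at most \<open>t\<close> to the power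
  \<open>- 1 - \<alpha> / 2\<close>, of differences between the scales \<open>r\<close> and \<open>r + 2 t\<close>; constants and linear functions
  do not contribute to these differences.  If the Taylor remainder of \<open>\<phi>\<close> at \<open>p\<close> were of order \<open>s > \<alpha>\<close>,
  the other terms would therefore be of smaller order than \<open>r\<close> to the power \<open>- 1 / 2\<close> as \<open>r\<close> tends to 0.
\<close>

subsection \<open>Gaussian integrals\<close>

text \<open>The exponents come from parabolic scaling. A dipole of variance r lives at distance sqrt
  r and has L1 norm of order \<open>r powr (- 1 / 2)\<close>. Its pairing with a remainder of order
  s therefore has order \<open>r powr ((s - 1) / 2)\<close>, and L costs a further factor
  \<open>r powr (- \<alpha> / 2)\<close>; the outcome is negligible against the jump exactly when
  \<open>\<alpha> < s\<close>. The heat kernel itself would see only a bounded average of the two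
  one-sided values, whereas the odd dipole removes constants and turns the jump into a divergence.
  The obstacle is that the symbol is not smooth at the origin for \<open>m = 0\<close>, so L does
  not preserve Schwartz functions, and no pointwise formula for L is at hand on its domain. Hence L
  is never moved onto the test function in space: at each frequency the symbol is replaced by an
  integral over t of Gaussian factors, and the transforms are paired only with explicit Gaussians.
  The bound \<open>s < 1 + \<alpha>\<close> makes the integral over t converge at infinity, where
  the moments of order s grow like \<open>t powr ((s - 1) / 2)\<close>. The mass enters through a
  factor at most 1, so all \<open>m \<ge> 0\<close> are treated at once.\<close>

lemma
  fixes f :: "'a::euclidean_space \<Rightarrow> real \<Rightarrow> 'b::{real_normed_field,banach,second_countable_topology}"
  assumes int: "\<And>b. b \<in> Basis \<Longrightarrow> integrable lborel (f b)"
  shows integrable_lborel_prod: "integrable lborel (\<lambda>x. \<Prod>b\<in>Basis. f b (x \<bullet> b))"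
    and integral_lborel_prod:
      "(\<integral>x. (\<Prod>b\<in>Basis. f b (x \<bullet> b)) \<partial>lborel) = (\<Prod>b\<in>Basis. integral\<^sup>L lborel (f b))"
proof -
  interpret product_sigma_finite "\<lambda>_::'a. lborel :: real measure" ..
  have [measurable]: "f b \<in> borel_measurable borel" if "b \<in> Basis" for b
    using int[OF that] by auto
  have coord: "(\<Prod>b\<in>Basis. f b ((\<Sum>c\<in>Basis. g c *\<^sub>R c) \<bullet> b)) = (\<Prod>b\<in>Basis. f b (g b))" for g
    by (intro prod.cong) auto
  have meas: "(\<lambda>x. \<Prod>b\<in>Basis. f b (x \<bullet> b)) \<in> borel_measurable borel"
    by measurable
  have meas': "(\<lambda>g. \<Sum>c\<in>Basis. g c *\<^sub>R c) \<in> (\<Pi>\<^sub>M b\<in>(Basis::'a set). lborel) \<rightarrow>\<^sub>M borel"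
    by measurable
  show "integrable lborel (\<lambda>x. \<Prod>b\<in>Basis. f b (x \<bullet> b))"
    unfolding lborel_eq[where 'a='a]
    by (subst integrable_distr_eq[OF meas' meas])
      (auto simp only: coord intro!: product_integrable_prod int finite_Basis)
  show "(\<integral>x. (\<Prod>b\<in>Basis. f b (x \<bullet> b)) \<partial>lborel) = (\<Prod>b\<in>Basis. integral\<^sup>L lborel (f b))"
    unfolding lborel_eq[where 'a='a]
    by (subst integral_distr[OF meas' meas])
      (auto simp only: coord intro!: product_integral_prod int finite_Basis)
qed

lemma lborel_affine_integrable_iff:
  fixes f :: "'a::euclidean_space \<Rightarrow> 'b::{banach, second_countable_topology}"
  assumes [measurable]: "f \<in> borel_measurable borel" and c: "c \<noteq> 0"
  shows "integrable lborel (\<lambda>x. f (t + c *\<^sub>R x)) \<longleftrightarrow> integrable lborel f"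
proof -
  have "integrable lborel f \<longleftrightarrow>
      integrable (density (distr lborel borel (\<lambda>x. t + c *\<^sub>R x)) (\<lambda>_. \<bar>c\<bar>^DIM('a))) f"
    by (simp flip: lborel_affine[OF c, of t])
  also have "\<dots> \<longleftrightarrow> integrable lborel (\<lambda>x. \<bar>c\<bar>^DIM('a) *\<^sub>R f (t + c *\<^sub>R x))"
    by (simp add: integrable_density integrable_distr_eq)
  also have "\<dots> \<longleftrightarrow> integrable lborel (\<lambda>x. f (t + c *\<^sub>R x))"
  proof
    assume "integrable lborel (\<lambda>x. \<bar>c\<bar>^DIM('a) *\<^sub>R f (t + c *\<^sub>R x))"
    from integrable_scaleR_right[OF this, of "1 / \<bar>c\<bar>^DIM('a)"] c
    show "integrable lborel (\<lambda>x. f (t + c *\<^sub>R x))"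
      by simp
  qed simp
  finally show ?thesis
    by simp
qed

text \<open>Serves three purposes below: \<open>c = sqrt r\<close> for parabolic scaling,
  \<open>c = 1\<close> for moving the origin to the boundary point, and \<open>c = - 1\<close> for
  the oddness of the dipole.\<close>

lemma lborel_affine_integral:
  fixes f :: "'a::euclidean_space \<Rightarrow> 'b::{banach, second_countable_topology}"
  assumes [measurable]: "f \<in> borel_measurable borel" and c: "c \<noteq> 0"
  shows "integral\<^sup>L lborel f = \<bar>c\<bar>^DIM('a) *\<^sub>R (\<integral>x. f (t + c *\<^sub>R x) \<partial>lborel)"
proof -
  have "integral\<^sup>L lborel f =
      integral\<^sup>L (density (distr lborel borel (\<lambda>x. t + c *\<^sub>R x)) (\<lambda>_. \<bar>c\<bar>^DIM('a))) f"
    by (simp flip: lborel_affine[OF c, of t])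
  also have "\<dots> = (\<integral>x. \<bar>c\<bar>^DIM('a) *\<^sub>R f (t + c *\<^sub>R x) \<partial>lborel)"
    by (subst integral_density) (auto simp: integral_distr)
  finally show ?thesis
    by simp
qed

lemma borel_measurable_cis [measurable (raw)]:
  "f \<in> borel_measurable M \<Longrightarrow> (\<lambda>x. cis (f x)) \<in> borel_measurable M"
  by (rule borel_measurable_continuous_on[OF continuous_on_cis[OF continuous_on_id]])

text \<open>The Gaussian is a multiple of the normal density with standard deviation
  \<open>1 / sqrt r\<close>. Finite normal moments give integrability, and after rescaling the
  transform is the characteristic function of the standard normal law at
  \<open>- y / sqrt r\<close>.\<close>

lemma
  fixes y :: real
  assumes r: "0 < r"
  shows integrable_gauss_real: "integrable lborel (\<lambda>x::real. cis (- (x * y)) * of_real (exp (- r * x\<^sup>2 / 2)))"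
    and integrable_gauss_moment_real:
      "integrable lborel (\<lambda>x::real. cis (- (x * y)) * of_real (x * exp (- r * x\<^sup>2 / 2)))"
    and integral_gauss_real: "(\<integral>x. cis (- (x * y)) * of_real (exp (- r * x\<^sup>2 / 2)) \<partial>lborel)
      = of_real (sqrt (2 * pi / r) * exp (- y\<^sup>2 / (2 * r)))"
proof -
  have nd: "exp (- r * x\<^sup>2 / 2) = sqrt (2 * pi / r) * normal_density 0 (1 / sqrt r) x" for x
    using r by (simp add: normal_density_def field_simps real_sqrt_divide real_sqrt_mult)
  have i0: "integrable lborel (\<lambda>x. exp (- r * x\<^sup>2 / 2))"
    unfolding nd using r by (intro integrable_mult_right) auto
  have i1: "integrable lborel (\<lambda>x. x * exp (- r * x\<^sup>2 / 2))"
    using integrable_mult_right[OF integrable_normal_moment[of "1 / sqrt r" 0 1], of "sqrt (2 * pi / r)"] r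
    unfolding nd by (simp add: mult_ac)
  show "integrable lborel (\<lambda>x::real. cis (- (x * y)) * of_real (exp (- r * x\<^sup>2 / 2)))"
    by (rule Bochner_Integration.integrable_bound[OF i0]) (auto simp: norm_mult)
  show "integrable lborel (\<lambda>x::real. cis (- (x * y)) * of_real (x * exp (- r * x\<^sup>2 / 2)))"
    by (rule Bochner_Integration.integrable_bound[OF i1]) (auto simp: norm_mult)
  have "(\<integral>x. cis (- (x * y)) * of_real (exp (- r * x\<^sup>2 / 2)) \<partial>lborel) =
     (1 / sqrt r) *\<^sub>R (\<integral>x. cis (- ((0 + 1 / sqrt r * x) * y)) * of_real (exp (- r * (0 + 1 / sqrt r * x)\<^sup>2 / 2)) \<partial>lborel)"
    using r by (subst lborel_integral_real_affine[of "1 / sqrt r" _ 0]) auto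
  also have "(\<integral>x. cis (- ((0 + 1 / sqrt r * x) * y)) * of_real (exp (- r * (0 + 1 / sqrt r * x)\<^sup>2 / 2)) \<partial>lborel)
     = (\<integral>x. complex_of_real (sqrt (2 * pi)) * (std_normal_density x *\<^sub>R iexp (- y / sqrt r * x)) \<partial>lborel)"
    using r by (intro Bochner_Integration.integral_cong)
      (auto simp: normal_density_def field_simps scaleR_conv_of_real cis_conv_exp)
  also have "\<dots> = sqrt (2 * pi) * char std_normal_distribution (- y / sqrt r)"
    unfolding char_def integral_mult_right_zero by (subst integral_density) simp_all
  also have "char std_normal_distribution (- y / sqrt r) = exp (- y\<^sup>2 / (2 * r))"
    using r unfolding char_std_normal_distribution by (simp add: power_divide)
  finally show "(\<integral>x. cis (- (x * y)) * of_real (exp (- r * x\<^sup>2 / 2)) \<partial>lborel)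
      = of_real (sqrt (2 * pi / r) * exp (- y\<^sup>2 / (2 * r)))"
    by (simp add: scaleR_conv_of_real real_sqrt_divide)
qed

lemma exp_neg_square_tendsto:
  assumes "0 < r"
  shows "((\<lambda>x::real. exp (- r * x\<^sup>2 / 2)) \<longlongrightarrow> 0) at_top" "((\<lambda>x::real. exp (- r * x\<^sup>2 / 2)) \<longlongrightarrow> 0) at_bot"
  using assms by real_asymp+

text \<open>\<open>?f\<close> is the derivative of \<open>?F\<close>, and \<open>?F\<close> vanishes
  at both ends of the line, so \<open>?f\<close> integrates to 0. This expresses the first moment by
  the plain Gaussian integral without differentiating under the integral sign.\<close>

lemma integral_gauss_moment_real:
  fixes y :: real
  assumes r: "0 < r"
  shows "(\<integral>x. cis (- (x * y)) * of_real (x * exp (- r * x\<^sup>2 / 2)) \<partial>lborel)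
      = - \<i> * of_real (y / r * (sqrt (2 * pi / r) * exp (- y\<^sup>2 / (2 * r))))"
proof -
  let ?F = "\<lambda>x::real. cis (- (x * y)) * of_real (exp (- r * x\<^sup>2 / 2))"
  let ?M = "\<lambda>x::real. cis (- (x * y)) * of_real (x * exp (- r * x\<^sup>2 / 2))"
  let ?f = "\<lambda>x::real. - \<i> * y * ?F x - r * ?M x"
  note i0 = integrable_gauss_real[OF r, of y] and i1 = integrable_gauss_moment_real[OF r, of y]
  have if': "integrable lborel ?f"
    using i0 i1 by auto
  have deriv: "(?F has_vector_derivative ?f x) (at x)" for x
    unfolding has_vector_derivative_complex_iff
    by (auto intro!: derivative_eq_intros simp: field_simps)
  have cont: "isCont ?f x" for x
  proof -
    have *: "isCont ?F x"
      using deriv by (rule has_vector_derivative_continuous)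
    have "isCont (\<lambda>x. - \<i> * y * ?F x - r * (of_real x * ?F x)) x"
      by (intro isCont_diff isCont_mult * continuous_const continuous_of_real continuous_ident)
    then show ?thesis
      by (simp only: of_real_mult mult.left_commute)
  qed
  have n: "norm (?F x) = exp (- r * x\<^sup>2 / 2)" for x
    by (simp add: norm_mult)
  have lim: "(?F \<longlongrightarrow> 0) at_top" "(?F \<longlongrightarrow> 0) at_bot"
    by (rule tendsto_norm_zero_cancel; simp only: n exp_neg_square_tendsto[OF r])+
  have "(LBINT x=-\<infinity>..\<infinity>. ?f x) = 0 - 0"
  proof (rule interval_integral_FTC_integrable[where F = ?F])
    show "((?F \<circ> real_of_ereal) \<longlongrightarrow> 0) (at_right (- \<infinity>))" "((?F \<circ> real_of_ereal) \<longlongrightarrow> 0) (at_left \<infinity>)"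
      unfolding ereal_tendsto_simps by (fact lim)+
    show "set_integrable lborel (einterval (- \<infinity>) \<infinity>) ?f"
      using if' by (simp add: set_integrable_def)
  qed (rule deriv cont | simp)+
  then have "integral\<^sup>L lborel ?f = 0"
    by (simp add: interval_lebesgue_integral_def set_lebesgue_integral_def)
  then have "- \<i> * y * integral\<^sup>L lborel ?F = r * integral\<^sup>L lborel ?M"
    using i0 i1 by simp
  then have "integral\<^sup>L lborel ?M = - \<i> * (y / r * integral\<^sup>L lborel ?F)"
    using r by (simp add: field_simps)
  then show ?thesis
    unfolding integral_gauss_real[OF r] by simp
qed

subsection \<open>Pairing the Plancherel transform with test functions\<close>

lemma L2_space_measurable: "f \<in> L2_space \<Longrightarrow> f \<in> borel_measurable borel"
  by (simp add: L2_space_def)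

lemma L2_space_mult_integrable:
  assumes "f \<in> L2_space" "g \<in> L2_space"
  shows "integrable lborel (\<lambda>x. f x * g x)"
proof -
  have [measurable]: "f \<in> borel_measurable borel" "g \<in> borel_measurable borel"
    using assms by (auto dest: L2_space_measurable)
  have int: "integrable lborel (\<lambda>x. (norm (f x))\<^sup>2 + (norm (g x))\<^sup>2)"
    using assms by (auto simp: L2_space_def)
  have *: "a * b \<le> a\<^sup>2 + b\<^sup>2" for a b :: real
    using zero_le_power2[of "a - b"] zero_le_power2[of a] zero_le_power2[of b]
    unfolding power2_diff by linarith
  show ?thesis
    by (rule Bochner_Integration.integrable_bound[OF int]) (auto simp: norm_mult *)
qed

text \<open>The multiplication formula for two L1 functions: the kernel is bounded and symmetric in
  x and y, so Fubini applies directly.\<close>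

lemma fourier_L1_swap:
  fixes f w :: "'a::euclidean_space \<Rightarrow> complex"
  assumes f: "integrable lborel f" and w: "integrable lborel w"
  shows "(\<integral>y. fourier_L1 f y * w y \<partial>lborel) = (\<integral>x. f x * fourier_L1 w x \<partial>lborel)"
proof -
  let ?c = "complex_of_real ((2 * pi) powr (- real DIM('a) / 2))"
  let ?h = "\<lambda>x y. cis (- (x \<bullet> y)) * (f x * w y)"
  have [measurable]: "f \<in> borel_measurable borel" "w \<in> borel_measurable borel"
    using f w by auto
  have "integrable (lborel \<Otimes>\<^sub>M lborel) (\<lambda>(x, y). ?h x y)"
  proof (rule lborel_pair.Fubini_integrable)
    show "(\<lambda>(x, y). ?h x y) \<in> borel_measurable (lborel \<Otimes>\<^sub>M lborel)"
      by measurable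
    have "integrable lborel (\<lambda>x. norm (f x) * (\<integral>y. norm (w y) \<partial>lborel))"
      using f by simp
    then show "integrable lborel (\<lambda>x. \<integral>y. norm (case (x, y) of (x, y) \<Rightarrow> ?h x y) \<partial>lborel)"
      by (simp add: norm_mult)
    show "AE x in lborel. integrable lborel (\<lambda>y. case (x, y) of (x, y) \<Rightarrow> ?h x y)"
    proof (rule AE_I2)
      fix x
      have "integrable lborel (\<lambda>y. f x * w y)"
        using w by simp
      then show "integrable lborel (\<lambda>y. case (x, y) of (x, y) \<Rightarrow> ?h x y)"
        by (rule Bochner_Integration.integrable_bound) (auto simp: norm_mult)
    qed
  qed
  then have "(\<integral>y. (\<integral>x. ?h x y \<partial>lborel) \<partial>lborel) = (\<integral>x. (\<integral>y. ?h x y \<partial>lborel) \<partial>lborel)"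
    by (rule lborel_pair.Fubini_integral)
  moreover have "fourier_L1 f y * w y = ?c * (\<integral>x. ?h x y \<partial>lborel)" for y
    by (simp add: fourier_L1_def flip: integral_mult_left_zero mult.assoc)
  moreover have "f x * fourier_L1 w x = ?c * (\<integral>y. ?h x y \<partial>lborel)" for x
  proof -
    have "f x * fourier_L1 w x = ?c * (f x * (\<integral>y. cis (- (y \<bullet> x)) * w y \<partial>lborel))"
      by (simp add: fourier_L1_def)
    also have "f x * (\<integral>y. cis (- (y \<bullet> x)) * w y \<partial>lborel) = (\<integral>y. ?h x y \<partial>lborel)"
      by (simp add: inner_commute mult.left_commute flip: integral_mult_right_zero)
    finally show ?thesis .
  qed
  ultimately show ?thesis
    by simp
qed

text \<open>On a ball of finite measure, \<open>norm (f x) \<le> 1 + (norm (f x))\<^sup>2\<close>.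
  This brings the truncations within reach of the multiplication formula.\<close>

lemma L2_space_truncate_integrable:
  assumes "f \<in> L2_space"
  shows "integrable lborel (\<lambda>x. indicator (ball 0 R) x * f x :: complex)"
proof -
  have [measurable]: "f \<in> borel_measurable borel"
    using assms by (rule L2_space_measurable)
  have int: "integrable lborel (\<lambda>x. indicator (ball 0 R) x + (norm (f x))\<^sup>2 :: real)"
    using assms emeasure_lborel_ball_finite[of 0 R]
    by (intro Bochner_Integration.integrable_add integrable_real_indicator) (auto simp: L2_space_def)
  have *: "a \<le> 1 + a\<^sup>2" for a :: real
    using zero_le_power2[of "1 - a"] zero_le_power2[of a] unfolding power2_diff one_power2 by linarith
  show ?thesis
    by (rule Bochner_Integration.integrable_bound[OF int]) (auto simp: indicator_def *)
qed

lemma fourier_L1_measurable: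
  assumes [measurable]: "f \<in> borel_measurable borel"
  shows "fourier_L1 f \<in> borel_measurable borel"
  unfolding fourier_L1_def[abs_def] by measurable

text \<open>Unlike Parseval's identity, this needs neither the Plancherel theorem nor Fourier inversion.\<close>

lemma plancherel_parseval:
  fixes f F w :: "'a::euclidean_space \<Rightarrow> complex"
  assumes P: "plancherel f F" and w: "integrable lborel w" "w \<in> L2_space"
    and W: "fourier_L1 w \<in> L2_space"
  shows "(\<integral>y. F y * w y \<partial>lborel) = (\<integral>x. f x * fourier_L1 w x \<partial>lborel)"
proof -
  define fn where "fn n x = indicator (ball 0 (real n)) x * f x" for n x
  have f: "f \<in> L2_space" and F: "F \<in> L2_space"
    and lim: "(\<lambda>n. \<integral>\<^sup>+y. ennreal ((norm (fourier_L1 (fn n) y - F y))\<^sup>2) \<partial>lborel) \<longlonglongrightarrow> 0"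
    using P by (auto simp: plancherel_def fn_def[abs_def])
  have [measurable]: "f \<in> borel_measurable borel" "F \<in> borel_measurable borel"
      "w \<in> borel_measurable borel" "fourier_L1 w \<in> borel_measurable borel"
    using f F w W by (auto dest: L2_space_measurable)
  have fn: "integrable lborel (fn n)" for n
    unfolding fn_def[abs_def] by (rule L2_space_truncate_integrable[OF f])
  have [measurable]: "fn n \<in> borel_measurable borel" "fourier_L1 (fn n) \<in> borel_measurable borel" for n
    using fn[of n] by (auto intro: fourier_L1_measurable)
  have swap: "(\<integral>y. fourier_L1 (fn n) y * w y \<partial>lborel) = (\<integral>x. fn n x * fourier_L1 w x \<partial>lborel)" for n
    by (rule fourier_L1_swap[OF fn w(1)])
  \<comment> \<open>The transform of a truncation is bounded by a multiple of its L1 norm and w is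
    integrable. Cauchy-Schwarz is not an option here, since the transform has not been shown to lie
    in \<open>L2_space\<close>.\<close>
  have fnhat_w: "integrable lborel (\<lambda>y. fourier_L1 (fn n) y * w y)" for n
  proof (rule Bochner_Integration.integrable_bound)
    let ?C = "(2 * pi) powr (- real DIM('a) / 2) * (\<integral>x. norm (fn n x) \<partial>lborel)"
    show "integrable lborel (\<lambda>y. ?C * norm (w y))"
      using w by auto
    have "norm (fourier_L1 (fn n) y) \<le> ?C" for y
      using integral_norm_bound[of lborel "\<lambda>x. cis (- (x \<bullet> y)) * fn n x"]
      by (auto simp: fourier_L1_def norm_mult intro!: mult_left_mono)
    then show "AE y in lborel. norm (fourier_L1 (fn n) y * w y) \<le> norm (?C * norm (w y))"
      by (auto simp: norm_mult intro!: mult_right_mono)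
  qed measurable
  have "(\<lambda>n. \<integral>x. fn n x * fourier_L1 w x \<partial>lborel) \<longlonglongrightarrow> (\<integral>x. f x * fourier_L1 w x \<partial>lborel)"
  proof (rule integral_dominated_convergence)
    show "integrable lborel (\<lambda>x. norm (f x * fourier_L1 w x))"
      using L2_space_mult_integrable[OF f W] by simp
    show "AE x in lborel. norm (fn n x * fourier_L1 w x) \<le> norm (f x * fourier_L1 w x)" for n
      by (auto simp: fn_def norm_mult indicator_def)
    show "AE x in lborel. (\<lambda>n. fn n x * fourier_L1 w x) \<longlonglongrightarrow> f x * fourier_L1 w x"
    proof (rule AE_I2)
      fix x :: 'a
      have "\<forall>\<^sub>F n in sequentially. norm x < real n"
        using filterlim_real_sequentially by (auto simp: filterlim_at_top_dense)
      then have "\<forall>\<^sub>F n in sequentially. fn n x * fourier_L1 w x = f x * fourier_L1 w x"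
        by eventually_elim (auto simp: fn_def)
      then show "(\<lambda>n. fn n x * fourier_L1 w x) \<longlonglongrightarrow> f x * fourier_L1 w x"
        by (rule tendsto_eventually)
    qed
  qed measurable
  moreover have "(\<lambda>n. \<integral>y. fourier_L1 (fn n) y * w y \<partial>lborel) \<longlonglongrightarrow> (\<integral>y. F y * w y \<partial>lborel)"
  proof -
    \<comment> \<open>Convergence in L2 implies convergence of the pairing with the fixed w. The
      estimate is made in \<open>ennreal\<close> because the L2 distances in
      \<open>plancherel\<close> are nonnegative integrals that may a priori be infinite.\<close>
    define B where "B = (\<integral>\<^sup>+y. ennreal ((norm (w y))\<^sup>2) \<partial>lborel)"
    have B: "B < \<infinity>"
      using w(2) unfolding L2_space_def B_def by (auto simp: integrable_iff_bounded)
    let ?D = "\<lambda>n. (\<integral>y. fourier_L1 (fn n) y * w y \<partial>lborel) - (\<integral>y. F y * w y \<partial>lborel)"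
    have bound: "ennreal ((norm (?D n))\<^sup>2) \<le>
        (\<integral>\<^sup>+y. ennreal ((norm (fourier_L1 (fn n) y - F y))\<^sup>2) \<partial>lborel) * B" for n
    proof -
      have int: "integrable lborel (\<lambda>y. (fourier_L1 (fn n) y - F y) * w y)"
        using fnhat_w[of n] L2_space_mult_integrable[OF F w(2)] by (simp add: left_diff_distrib)
      have "?D n = (\<integral>y. (fourier_L1 (fn n) y - F y) * w y \<partial>lborel)"
        using fnhat_w L2_space_mult_integrable[OF F w(2)] by (simp add: left_diff_distrib)
      then have "ennreal (norm (?D n)) \<le> (\<integral>\<^sup>+y. norm ((fourier_L1 (fn n) y - F y) * w y) \<partial>lborel)"
        using integral_norm_bound_ennreal[OF int] by simp
      also have "\<dots> = (\<integral>\<^sup>+y. ennreal (norm (fourier_L1 (fn n) y - F y)) * ennreal (norm (w y)) \<partial>lborel)"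
        by (simp add: norm_mult ennreal_mult)
      finally have "(ennreal (norm (?D n)))\<^sup>2 \<le> \<dots>\<^sup>2"
        by (rule power_mono) simp
      also have "\<dots> \<le> (\<integral>\<^sup>+y. (ennreal (norm (fourier_L1 (fn n) y - F y)))\<^sup>2 \<partial>lborel)
          * (\<integral>\<^sup>+y. (ennreal (norm (w y)))\<^sup>2 \<partial>lborel)"
        by (rule Cauchy_Schwarz_nn_integral) auto
      finally show ?thesis
        by (simp add: B_def ennreal_power)
    qed
    have limB: "(\<lambda>n. (\<integral>\<^sup>+y. ennreal ((norm (fourier_L1 (fn n) y - F y))\<^sup>2) \<partial>lborel) * B) \<longlonglongrightarrow> 0"
      using tendsto_mult_ennreal[OF lim tendsto_const[of B]] B by simp
    have "(\<lambda>n. ennreal ((norm (?D n))\<^sup>2)) \<longlonglongrightarrow> 0"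
    proof (rule tendsto_sandwich[OF _ _ tendsto_const limB])
      show "\<forall>\<^sub>F n in sequentially. 0 \<le> ennreal ((norm (?D n))\<^sup>2)"
        by simp
      show "\<forall>\<^sub>F n in sequentially. ennreal ((norm (?D n))\<^sup>2) \<le>
          (\<integral>\<^sup>+y. ennreal ((norm (fourier_L1 (fn n) y - F y))\<^sup>2) \<partial>lborel) * B"
        by (intro always_eventually allI bound)
    qed
    then have "(\<lambda>n. ennreal ((norm (?D n))\<^sup>2)) \<longlonglongrightarrow> ennreal 0"
      by simp
    then have "(\<lambda>n. (norm (?D n))\<^sup>2) \<longlonglongrightarrow> 0"
      by (subst (asm) tendsto_ennreal_iff) (rule always_eventually, simp_all)
    from tendsto_real_sqrt[OF this] have "(\<lambda>n. norm (?D n)) \<longlonglongrightarrow> 0"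
      by simp
    then show ?thesis
      by (simp add: LIM_zero_iff tendsto_norm_zero_iff)
  qed
  ultimately show ?thesis
    unfolding swap by (rule LIMSEQ_unique[rotated])
qed

subsection \<open>Heat dipoles\<close>

text \<open>Raise \<open>x / q \<le> exp (x / q)\<close> to the power q, which gives the constant
  \<open>q powr q\<close>. The case \<open>q = 0\<close> is separate because of the division by
  q.\<close>

lemma powr_le_const_mult_exp:
  fixes q :: real
  assumes "0 \<le> q"
  obtains K where "0 \<le> K" "\<And>x. 0 \<le> x \<Longrightarrow> x powr q \<le> K * exp x"
proof (cases "q = 0")
  case True
  then show ?thesis
    by (intro that[of 1]) (auto simp: powr_def)
next
  case False
  with assms have q: "0 < q" by simp
  have "x powr q \<le> q powr q * exp x" if "0 \<le> x" for x
  proof -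
    have "x / q \<le> exp (x / q)"
      using exp_ge_add_one_self[of "x / q"] by linarith
    then have "(x / q) powr q \<le> exp (x / q) powr q"
      using that q by (intro powr_mono2) auto
    also have "\<dots> = exp x"
      using q by (simp add: powr_def)
    finally have "q powr q * (x / q) powr q \<le> q powr q * exp x"
      by (intro mult_left_mono) auto
    then show ?thesis
      using that q by (simp flip: powr_mult)
  qed
  then show ?thesis
    by (intro that[of "q powr q"]) auto
qed

lemma gauss_eq_prod:
  fixes y :: "'a::euclidean_space"
  shows "exp (- r * (norm y)\<^sup>2 / 2) = (\<Prod>b\<in>Basis. exp (- r * (y \<bullet> b)\<^sup>2 / 2))"
proof -
  have "(norm y)\<^sup>2 = (\<Sum>b\<in>Basis. (y \<bullet> b)\<^sup>2)"
    unfolding power2_norm_eq_inner by (subst euclidean_inner) (simp add: power2_eq_square)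
  then show ?thesis
    by (simp add: exp_sum[symmetric] sum_distrib_left sum_divide_distrib sum_negf)
qed

text \<open>Half of the Gaussian absorbs the power of the norm; the other half is still a Gaussian
  and factorises over the coordinates.\<close>

lemma integrable_gauss_moment:
  assumes p: "0 \<le> p" and c: "0 < c"
  shows "integrable lborel (\<lambda>u::'a::euclidean_space. norm u powr p * exp (- c * (norm u)\<^sup>2))"
proof -
  obtain K where K: "0 \<le> K" "\<And>x. 0 \<le> x \<Longrightarrow> x powr (p / 2) \<le> K * exp x"
    using powr_le_const_mult_exp[of "p / 2"] p by auto
  have g: "integrable lborel (\<lambda>x. exp (- c * x\<^sup>2 / 2))"
    using integrable_norm[OF integrable_gauss_real[OF c, of 0]] by simp
  have int: "integrable lborel (\<lambda>u::'a. (2 / c) powr (p / 2) * K * exp (- c * (norm u)\<^sup>2 / 2))"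
    unfolding gauss_eq_prod by (intro integrable_mult_right integrable_lborel_prod g)
  show ?thesis
  proof (rule Bochner_Integration.integrable_bound[OF int], measurable, rule AE_I2)
    fix u :: 'a
    define x where "x = c * (norm u)\<^sup>2 / 2"
    have x: "0 \<le> x" using c by (simp add: x_def)
    have "norm u powr p = (norm u powr 2) powr (p / 2)"
      by (simp only: powr_powr) simp
    also have "norm u powr 2 = (2 / c) * x"
      using c by (simp add: x_def)
    also have "\<dots> powr (p / 2) = (2 / c) powr (p / 2) * x powr (p / 2)"
      by (rule powr_mult)
    finally have "norm u powr p * exp (- c * (norm u)\<^sup>2) =
        (2 / c) powr (p / 2) * (x powr (p / 2) * exp (- x) * exp (- x))"
      by (simp add: x_def flip: exp_add)
    also have "\<dots> \<le> (2 / c) powr (p / 2) * (K * exp x * exp (- x) * exp (- x))"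
      using K(2)[OF x] by (intro mult_left_mono mult_right_mono) auto
    also have "\<dots> = (2 / c) powr (p / 2) * K * exp (- c * (norm u)\<^sup>2 / 2)"
      by (simp add: x_def flip: exp_add)
    finally show "norm (norm u powr p * exp (- c * (norm u)\<^sup>2))
        \<le> norm ((2 / c) powr (p / 2) * K * exp (- c * (norm u)\<^sup>2 / 2))"
      using K(1) by (simp add: abs_mult)
  qed
qed

text \<open>Up to a constant factor, the derivative in direction \<open>e\<close> of the heat kernel with variance \<open>r\<close>.\<close>

definition heat_dipole :: "'a::euclidean_space \<Rightarrow> real \<Rightarrow> 'a \<Rightarrow> real" where
  "heat_dipole e r u = (u \<bullet> e) * r powr (- (real DIM('a) / 2 + 1)) * exp (- (norm u)\<^sup>2 / (2 * r))"

text \<open>The frequency-side counterpart of the dipole: the factor \<open>y \<bullet> e\<close>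
  produces the derivative in direction e, the phase moves the centre to p. Starting on the frequency
  side means that only the forward transform of an explicit function is ever computed.\<close>

definition modulated_gauss :: "'a::euclidean_space \<Rightarrow> real \<Rightarrow> 'a \<Rightarrow> 'a \<Rightarrow> complex" where
  "modulated_gauss e r p y = cis (p \<bullet> y) * of_real ((y \<bullet> e) * exp (- r * (norm y)\<^sup>2 / 2))"

lemma heat_dipole_measurable [measurable]: "heat_dipole e r \<in> borel_measurable borel"
  unfolding heat_dipole_def[abs_def] by measurable

lemma modulated_gauss_measurable [measurable]: "modulated_gauss e r p \<in> borel_measurable borel"
  unfolding modulated_gauss_def[abs_def] by measurable

text \<open>Phase and Gaussian factorise over the coordinates, and for a basis vector e the factor
  \<open>y \<bullet> e\<close> touches a single coordinate, which contributes a first moment; all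
  others are plain Gaussian integrals. The exponent \<open>- (real DIM('a) / 2 + 1)\<close> collects
  \<open>r powr (- 1 / 2)\<close> per coordinate and \<open>1 / r\<close> from the moment.\<close>

lemma fourier_L1_modulated_gauss:
  fixes e :: "'a::euclidean_space"
  assumes e: "e \<in> Basis" and r: "0 < r"
  shows "fourier_L1 (modulated_gauss e r p) z = - \<i> * of_real (heat_dipole e r (z - p))"
proof -
  let ?w = "z - p"
  define f :: "'a \<Rightarrow> real \<Rightarrow> complex" where
    "f b t = cis (- (t * (?w \<bullet> b))) * of_real ((if b = e then t else 1) * exp (- r * t\<^sup>2 / 2))" for b t
  have int: "integrable lborel (f b)" for b
    unfolding f_def[abs_def]
    using integrable_gauss_real[OF r, of "?w \<bullet> b"] integrable_gauss_moment_real[OF r, of "?w \<bullet> b"]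
    by (cases "b = e") auto
  have val: "integral\<^sup>L lborel (f b) = (if b = e then - \<i> * of_real (?w \<bullet> e / r) else 1) *
      of_real (sqrt (2 * pi / r) * exp (- (?w \<bullet> b)\<^sup>2 / (2 * r)))" for b
    unfolding f_def[abs_def]
    using integral_gauss_real[OF r, of "?w \<bullet> b"] integral_gauss_moment_real[OF r, of "?w \<bullet> b"]
    by (cases "b = e") (simp_all add: mult.assoc)
  have split: "cis (- (y \<bullet> z)) * modulated_gauss e r p y = (\<Prod>b\<in>Basis. f b (y \<bullet> b))" for y
  proof -
    have "(\<Prod>b\<in>Basis. cis (- ((y \<bullet> b) * (?w \<bullet> b)))) = cis (\<Sum>b\<in>Basis. - ((y \<bullet> b) * (?w \<bullet> b)))"
      by (simp add: cis_conv_exp exp_sum sum_distrib_left)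
    also have "(\<Sum>b\<in>Basis. - ((y \<bullet> b) * (?w \<bullet> b))) = - (y \<bullet> ?w)"
      by (subst euclidean_inner) (simp add: sum_negf)
    finally have "(\<Prod>b\<in>Basis. cis (- ((y \<bullet> b) * (?w \<bullet> b)))) = cis (- (y \<bullet> z)) * cis (p \<bullet> y)"
      by (simp add: cis_mult inner_diff_right inner_commute)
    moreover have "(\<Prod>b\<in>Basis. (if b = e then y \<bullet> b else 1)) = y \<bullet> e"
      using e by (simp add: prod.delta)
    ultimately show ?thesis
      by (simp only: f_def prod.distrib of_real_prod[symmetric] gauss_eq_prod[symmetric]
          modulated_gauss_def mult.assoc of_real_mult)
  qed
  have "(\<Prod>b\<in>(Basis::'a set). sqrt (2 * pi / r)) = (2 * pi / r) powr (real DIM('a) / 2)"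
    using r by (simp add: powr_half_sqrt[symmetric] powr_powr powr_realpow[symmetric])
  moreover have "(2 * pi) powr (- real DIM('a) / 2) * (2 * pi / r) powr (real DIM('a) / 2) = r powr (- (real DIM('a) / 2))"
    using r by (simp add: powr_divide powr_minus divide_simps)
  ultimately have const: "(2 * pi) powr (- real DIM('a) / 2) * (\<Prod>b\<in>(Basis::'a set). sqrt (2 * pi / r)) / r
      = r powr (- (real DIM('a) / 2 + 1))"
    using r by (simp add: powr_diff)
  have expw: "(\<Prod>b\<in>Basis. exp (- (?w \<bullet> b)\<^sup>2 / (2 * r))) = exp (- (norm ?w)\<^sup>2 / (2 * r))"
    using gauss_eq_prod[of "1 / r" ?w] by (simp add: mult.commute)
  have "fourier_L1 (modulated_gauss e r p) z =
      of_real ((2 * pi) powr (- real DIM('a) / 2)) * (\<Prod>b\<in>Basis. integral\<^sup>L lborel (f b))"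
    unfolding fourier_L1_def split by (subst integral_lborel_prod[OF int]) simp
  also have "(\<Prod>b\<in>Basis. integral\<^sup>L lborel (f b)) = - \<i> * of_real (?w \<bullet> e / r) *
      of_real ((\<Prod>b\<in>(Basis::'a set). sqrt (2 * pi / r)) * exp (- (norm ?w)\<^sup>2 / (2 * r)))"
    unfolding val prod.distrib expw[symmetric] of_real_mult of_real_prod using e by (simp add: prod.delta)
  also have "of_real ((2 * pi) powr (- real DIM('a) / 2)) * \<dots> = - \<i> * of_real ((?w \<bullet> e) *
     ((2 * pi) powr (- real DIM('a) / 2) * (\<Prod>b\<in>(Basis::'a set). sqrt (2 * pi / r)) / r) * exp (- (norm ?w)\<^sup>2 / (2 * r)))"
    by simp
  finally show ?thesis
    unfolding const heat_dipole_def .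
qed

lemma abs_inner_Basis_le: "e \<in> Basis \<Longrightarrow> \<bar>u \<bullet> e\<bar> \<le> norm u"
  using Basis_le_norm[of e u] by simp

lemma heat_dipole_abs_le:
  assumes "e \<in> Basis"
  shows "\<bar>heat_dipole e r (u::'a::euclidean_space)\<bar> \<le>
    r powr (- (real DIM('a) / 2 + 1)) * (norm u powr 1 * exp (- (norm u)\<^sup>2 / (2 * r)))"
proof -
  have "\<bar>heat_dipole e r u\<bar> = \<bar>u \<bullet> e\<bar> * (r powr (- (real DIM('a) / 2 + 1)) * exp (- (norm u)\<^sup>2 / (2 * r)))"
    by (simp add: heat_dipole_def abs_mult)
  also have "\<dots> \<le> norm u * (r powr (- (real DIM('a) / 2 + 1)) * exp (- (norm u)\<^sup>2 / (2 * r)))"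
    using abs_inner_Basis_le[OF assms] by (intro mult_right_mono) auto
  finally show ?thesis
    by (simp add: mult_ac)
qed

lemma integrable_heat_dipole_moment:
  fixes e :: "'a::euclidean_space"
  assumes e: "e \<in> Basis" and r: "0 < r" and s: "0 \<le> s"
  shows "integrable lborel (\<lambda>u. norm u powr s * \<bar>heat_dipole e r u\<bar>)"
proof -
  let ?k = "r powr (- (real DIM('a) / 2 + 1))"
  have int: "integrable lborel (\<lambda>u::'a. ?k * (norm u powr (s + 1) * exp (- (1 / (2 * r)) * (norm u)\<^sup>2)))"
    using r s by (intro integrable_mult_right integrable_gauss_moment) auto
  show ?thesis
  proof (rule Bochner_Integration.integrable_bound[OF int], measurable, rule AE_I2)
    fix u :: 'a
    have "norm u powr s * \<bar>heat_dipole e r u\<bar> \<le>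
        norm u powr s * (?k * (norm u powr 1 * exp (- (norm u)\<^sup>2 / (2 * r))))"
      by (intro mult_left_mono heat_dipole_abs_le[OF e]) auto
    also have "\<dots> = ?k * (norm u powr (s + 1) * exp (- (1 / (2 * r)) * (norm u)\<^sup>2))"
      unfolding powr_add by (simp add: mult_ac)
    finally show "norm (norm u powr s * \<bar>heat_dipole e r u\<bar>) \<le>
        norm (?k * (norm u powr (s + 1) * exp (- (1 / (2 * r)) * (norm u)\<^sup>2)))"
      by simp
  qed
qed

lemma integrable_heat_dipole:
  fixes e :: "'a::euclidean_space"
  assumes e: "e \<in> Basis" and r: "0 < r"
  shows "integrable lborel (heat_dipole e r)"
proof (rule Bochner_Integration.integrable_bound[OF integrable_heat_dipole_moment[OF e r order_refl]])
  \<comment> \<open>At \<open>u = 0\<close> the majorant is 0, because \<open>0 powr 0 = 0\<close>;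
    the dipole vanishes there as well.\<close>
  show "AE u in lborel. norm (heat_dipole e r u) \<le> norm (norm u powr 0 * \<bar>heat_dipole e r u\<bar>)"
    by (intro AE_I2) (auto simp: heat_dipole_def)
qed simp

lemma heat_dipole_L2:
  fixes e :: "'a::euclidean_space"
  assumes e: "e \<in> Basis" and r: "0 < r"
  shows "integrable lborel (\<lambda>u. (heat_dipole e r u)\<^sup>2)"
proof -
  let ?k = "r powr (- (real DIM('a) / 2 + 1))"
  have int: "integrable lborel (\<lambda>u::'a. ?k\<^sup>2 * (norm u powr 2 * exp (- (1 / r) * (norm u)\<^sup>2)))"
    using r by (intro integrable_mult_right integrable_gauss_moment) auto
  show ?thesis
  proof (rule Bochner_Integration.integrable_bound[OF int], measurable, rule AE_I2)
    fix u :: 'a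
    have "\<bar>heat_dipole e r u\<bar>\<^sup>2 \<le> (?k * (norm u powr 1 * exp (- (norm u)\<^sup>2 / (2 * r))))\<^sup>2"
      by (intro power_mono heat_dipole_abs_le[OF e]) auto
    also have "\<dots> = ?k\<^sup>2 * (norm u powr 2 * exp (- (1 / r) * (norm u)\<^sup>2))"
      by (simp add: power_mult_distrib power2_eq_square flip: exp_add)
    finally show "norm ((heat_dipole e r u)\<^sup>2) \<le> norm (?k\<^sup>2 * (norm u powr 2 * exp (- (1 / r) * (norm u)\<^sup>2)))"
      by simp
  qed
qed

lemma modulated_gauss_integrable:
  fixes e :: "'a::euclidean_space"
  assumes e: "e \<in> Basis" and r: "0 < r"
  shows "integrable lborel (modulated_gauss e r p)"
proof -
  have int: "integrable lborel (\<lambda>u::'a. norm u powr 1 * exp (- (r / 2) * (norm u)\<^sup>2))"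
    using r by (intro integrable_gauss_moment) auto
  show ?thesis
    by (rule Bochner_Integration.integrable_bound[OF int])
      (auto simp: modulated_gauss_def norm_mult abs_inner_Basis_le[OF e] intro!: mult_right_mono)
qed

text \<open>The weight is quadratic because the symbol of \<open>L\<close> grows at most quadratically.\<close>

lemma modulated_gauss_weighted_L2:
  fixes e :: "'a::euclidean_space"
  assumes e: "e \<in> Basis" and r: "0 < r"
  shows "(\<lambda>y. of_real ((norm y)\<^sup>2) * modulated_gauss e r p y) \<in> L2_space"
    and "modulated_gauss e r p \<in> L2_space"
proof -
  have int: "integrable lborel (\<lambda>u::'a. norm u powr k * exp (- r * (norm u)\<^sup>2))" if "0 \<le> k" for k
    using r that by (intro integrable_gauss_moment) auto
  have sq: "(norm (modulated_gauss e r p y))\<^sup>2 \<le> norm y powr 2 * exp (- r * (norm y)\<^sup>2)" for y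
  proof -
    have "(norm (modulated_gauss e r p y))\<^sup>2 = \<bar>y \<bullet> e\<bar>\<^sup>2 * exp (- r * (norm y)\<^sup>2)"
      by (simp add: modulated_gauss_def norm_mult power_mult_distrib power2_eq_square[of "exp _"] flip: exp_add)
    also have "\<dots> \<le> (norm y)\<^sup>2 * exp (- r * (norm y)\<^sup>2)"
      by (intro mult_right_mono power_mono abs_inner_Basis_le[OF e]) auto
    finally show ?thesis
      by simp
  qed
  have "integrable lborel (\<lambda>y. (norm (modulated_gauss e r p y))\<^sup>2)"
    by (rule Bochner_Integration.integrable_bound[OF int[of 2]]) (use sq in auto)
  then show "modulated_gauss e r p \<in> L2_space"
    by (simp add: L2_space_def)
  have "integrable lborel (\<lambda>y. (norm (of_real ((norm y)\<^sup>2) * modulated_gauss e r p y))\<^sup>2)"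
  \<comment> \<open>Moment 6: four powers from the squared quadratic weight, two from the squared
    factor \<open>y \<bullet> e\<close>.\<close>
  proof (rule Bochner_Integration.integrable_bound[OF int[of 6]], simp, measurable, rule AE_I2)
    fix y :: 'a
    have "(norm (of_real ((norm y)\<^sup>2) * modulated_gauss e r p y))\<^sup>2 = norm y ^ 4 * (norm (modulated_gauss e r p y))\<^sup>2"
      by (simp add: norm_mult power_mult_distrib del: of_real_power flip: power_mult)
    also have "\<dots> \<le> norm y ^ 4 * (norm y powr 2 * exp (- r * (norm y)\<^sup>2))"
      by (intro mult_left_mono sq) auto
    also have "\<dots> = norm y powr 6 * exp (- r * (norm y)\<^sup>2)"
      by (simp flip: power_add)
    finally show "norm ((norm (of_real ((norm y)\<^sup>2) * modulated_gauss e r p y))\<^sup>2)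
        \<le> norm (norm y powr 6 * exp (- r * (norm y)\<^sup>2))"
      by simp
  qed
  then show "(\<lambda>y. of_real ((norm y)\<^sup>2) * modulated_gauss e r p y) \<in> L2_space"
    by (simp add: L2_space_def)
qed

section \<open>Parabolic scaling of the dipoles\<close>

lemma heat_dipole_scale:
  fixes e :: "'a::euclidean_space"
  assumes "0 < r" "0 < k"
  shows "heat_dipole e (k * r) (sqrt r *\<^sub>R w) = r powr (- (real DIM('a) + 1) / 2) * heat_dipole e k w"
proof -
  have "- (norm (sqrt r *\<^sub>R w))\<^sup>2 / (2 * (k * r)) = - (norm w)\<^sup>2 / (2 * k)"
    using assms by (simp add: power_mult_distrib)
  moreover have "sqrt r * r powr (- (real DIM('a) / 2 + 1)) = r powr (- (real DIM('a) + 1) / 2)"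
    using assms by (simp add: powr_half_sqrt[symmetric] field_simps flip: powr_add)
  ultimately show ?thesis
    using assms by (simp add: heat_dipole_def powr_mult)
qed

text \<open>The Jacobian \<open>sqrt r ^ DIM('a)\<close> cancels all but
  \<open>r powr (- 1 / 2)\<close> of the scaling factor; what is left is the cost of the single
  derivative and fixes the order of the jump term.\<close>

lemma integral_heat_dipole_scale:
  fixes e :: "'a::euclidean_space" and h :: "'a \<Rightarrow> real"
  assumes r: "0 < r" and k: "0 < k" and [measurable]: "h \<in> borel_measurable borel"
  shows "(\<integral>u. h u * heat_dipole e (k * r) u \<partial>lborel) =
    r powr (- 1 / 2) * (\<integral>w. h (sqrt r *\<^sub>R w) * heat_dipole e k w \<partial>lborel)"
proof -
  have "(\<integral>u. h u * heat_dipole e (k * r) u \<partial>lborel) =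
      sqrt r ^ DIM('a) * (\<integral>w. h (sqrt r *\<^sub>R w) * heat_dipole e (k * r) (sqrt r *\<^sub>R w) \<partial>lborel)"
    using r by (subst lborel_affine_integral[of _ "sqrt r" 0]) auto
  also have "\<dots> = sqrt r ^ DIM('a) * r powr (- (real DIM('a) + 1) / 2) *
      (\<integral>w. h (sqrt r *\<^sub>R w) * heat_dipole e k w \<partial>lborel)"
    unfolding heat_dipole_scale[OF r k]
      mult.left_commute[of _ "r powr (- (real DIM('a) + 1) / 2)"] integral_mult_right_zero
    by simp
  also have "sqrt r ^ DIM('a) * r powr (- (real DIM('a) + 1) / 2) = r powr (- 1 / 2)"
    using r by (simp add: powr_half_sqrt[symmetric] powr_power add_divide_distrib diff_divide_distrib flip: powr_add)
  finally show ?thesis .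
qed

subsection \<open>Subordination\<close>

text \<open>The Gamma integral at \<open>1 - \<beta>\<close> after the substitution of
  \<open>s * t\<close> for t.\<close>

lemma nn_integral_powr_exp:
  fixes s \<beta> :: real
  assumes s: "0 < s" and \<beta>: "\<beta> < 1"
  shows "(\<integral>\<^sup>+t. ennreal (indicator {0<..} t * (t powr (- \<beta>) * exp (- (t * s)))) \<partial>lborel)
    = ennreal (Gamma (1 - \<beta>) * s powr (\<beta> - 1))"
    (is "?I = _")
proof -
  have "ennreal (Gamma (1 - \<beta>)) =
      (\<integral>\<^sup>+t. ennreal (indicator {0..} t * t powr (- \<beta>) / exp t) \<partial>lborel)"
    using Gamma_conv_nn_integral_real[of "1 - \<beta>"] \<beta> by simp
  also have "\<dots> = ennreal s * (\<integral>\<^sup>+t. ennreal (indicator {0..} (0 + s * t) * (0 + s * t) powr (- \<beta>) / exp (0 + s * t)) \<partial>lborel)"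
    using s by (subst nn_integral_real_affine[of _ s 0]) auto
  \<comment> \<open>The indicators of \<open>{0..}\<close> and \<open>{0<..}\<close> differ only at
    \<open>t = 0\<close>, where the power of 0 is 0.\<close>
  also have "(\<integral>\<^sup>+t. ennreal (indicator {0..} (0 + s * t) * (0 + s * t) powr (- \<beta>) / exp (0 + s * t)) \<partial>lborel)
      = (\<integral>\<^sup>+t. ennreal (s powr (- \<beta>)) * ennreal (indicator {0<..} t * (t powr (- \<beta>) * exp (- (t * s)))) \<partial>lborel)"
    using s by (intro nn_integral_cong, subst ennreal_mult[symmetric])
      (auto simp: indicator_def powr_mult exp_minus field_simps zero_le_mult_iff)
  also have "\<dots> = ennreal (s powr (- \<beta>)) * ?I"
    by (subst nn_integral_cmult) auto
  finally have "ennreal (Gamma (1 - \<beta>)) = ennreal (s * s powr (- \<beta>)) * ?I"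
    using s by (simp add: ennreal_mult mult.assoc)
  then have "ennreal (Gamma (1 - \<beta>)) * ennreal (s powr (\<beta> - 1)) =
      ennreal (s * s powr (- \<beta>) * s powr (\<beta> - 1)) * ?I"
    using s by (simp add: ennreal_mult mult_ac)
  moreover have "s * s powr (- \<beta>) * s powr (\<beta> - 1) = 1"
    using s by (simp add: powr_minus powr_diff)
  ultimately show ?thesis
    using \<beta> by (simp add: ennreal_mult Gamma_real_nonneg)
qed

text \<open>Write \<open>1 - exp (- t z)\<close> as \<open>t\<close> times the integral of \<open>exp (- t s)\<close> over \<open>0 \<le> s \<le> z\<close> and apply Tonelli.\<close>

lemma nn_integral_subordination:
  fixes c z \<beta> :: real
  assumes c: "0 \<le> c" and z: "0 \<le> z" and \<beta>: "0 < \<beta>" "\<beta> < 1"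
  shows "(\<integral>\<^sup>+t. ennreal (indicator {0<..} t * (exp (- (t * c)) * (1 - exp (- (t * z))) * t powr (- 1 - \<beta>))) \<partial>lborel)
    = ennreal (Gamma (1 - \<beta>) / \<beta> * ((z + c) powr \<beta> - c powr \<beta>))"
proof -
  let ?h = "\<lambda>s t. ennreal (indicator {0..z} s * (indicator {0<..} t * (t powr (- \<beta>) * exp (- (t * (c + s))))))"
  have inner_s: "(\<integral>\<^sup>+s. ?h s t \<partial>lborel) =
      ennreal (indicator {0<..} t * (exp (- (t * c)) * (1 - exp (- (t * z))) * t powr (- 1 - \<beta>)))" for t
  proof (cases "0 < t")
    case True
    have "((\<lambda>s. exp (- (t * s))) has_integral (- exp (- (t * z)) / t - (- exp (- (t * 0)) / t))) {0..z}"
      using z True by (intro fundamental_theorem_of_calculus)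
        (auto intro!: derivative_eq_intros simp: has_real_derivative_iff_has_vector_derivative[symmetric])
    from nn_integral_has_integral_lebesgue[OF _ this]
    have I: "(\<integral>\<^sup>+s. ennreal (indicator {0..z} s * exp (- (t * s))) \<partial>lborel) = ennreal ((1 - exp (- (t * z))) / t)"
      by (simp add: diff_divide_distrib)
    have "(\<integral>\<^sup>+s. ?h s t \<partial>lborel) =
       (\<integral>\<^sup>+s. ennreal (t powr (- \<beta>) * exp (- (t * c))) * ennreal (indicator {0..z} s * exp (- (t * s))) \<partial>lborel)"
      using True by (intro nn_integral_cong, subst ennreal_mult[symmetric])
        (auto simp: indicator_def distrib_left mult_ac simp flip: exp_add)
    also have "\<dots> = ennreal (t powr (- \<beta>) * exp (- (t * c))) * ennreal ((1 - exp (- (t * z))) / t)"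
      by (subst nn_integral_cmult) (auto simp: I)
    also have "\<dots> = ennreal (t powr (- \<beta>) * exp (- (t * c)) * ((1 - exp (- (t * z))) / t))"
      using True z by (subst ennreal_mult) auto
    also have "t powr (- \<beta>) * exp (- (t * c)) * ((1 - exp (- (t * z))) / t) =
        indicator {0<..} t * (exp (- (t * c)) * (1 - exp (- (t * z))) * t powr (- 1 - \<beta>))"
      using True by (simp add: powr_diff powr_minus field_simps)
    finally show ?thesis .
  qed simp
  have "((\<lambda>s. (c + s) powr (\<beta> - 1)) has_integral ((c + z) powr \<beta> / \<beta> - (c + 0) powr \<beta> / \<beta>)) {0..z}"
  \<comment> \<open>For \<open>c = 0\<close> the antiderivative is not differentiable at
    \<open>s = 0\<close>; at the endpoints only its continuity is used.\<close>
  proof (rule fundamental_theorem_of_calculus_interior[OF z])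
    show "continuous_on {0..z} (\<lambda>s. (c + s) powr \<beta> / \<beta>)"
      using c \<beta> by (intro continuous_on_divide continuous_on_powr' continuous_intros) auto
    show "((\<lambda>s. (c + s) powr \<beta> / \<beta>) has_vector_derivative (c + s) powr (\<beta> - 1)) (at s)" if "s \<in> {0<..<z}" for s
      using that c \<beta> by (auto intro!: derivative_eq_intros simp: has_real_derivative_iff_has_vector_derivative[symmetric])
  qed
  from nn_integral_has_integral_lebesgue[OF _ this]
  have J: "(\<integral>\<^sup>+s. ennreal (indicator {0..z} s * (c + s) powr (\<beta> - 1)) \<partial>lborel)
      = ennreal (((z + c) powr \<beta> - c powr \<beta>) / \<beta>)"
    by (simp add: diff_divide_distrib add.commute)
  \<comment> \<open>For \<open>c = 0\<close> and \<open>s = 0\<close> the left side is infinite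
    while the right side is 0, again because a power of 0 is 0. A single point is a null set for the
    outer integral.\<close>
  have inner_t: "(\<integral>\<^sup>+t. ?h s t \<partial>lborel) =
      ennreal (Gamma (1 - \<beta>)) * ennreal (indicator {0..z} s * (c + s) powr (\<beta> - 1))" if "s \<noteq> 0" for s
  proof (cases "s \<in> {0..z}")
    case True
    then show ?thesis
      using that c \<beta> nn_integral_powr_exp[of "c + s" \<beta>] by (simp add: ennreal_mult Gamma_real_nonneg)
  qed simp
  have "(\<integral>\<^sup>+t. (\<integral>\<^sup>+s. ?h s t \<partial>lborel) \<partial>lborel) = (\<integral>\<^sup>+s. (\<integral>\<^sup>+t. ?h s t \<partial>lborel) \<partial>lborel)"
    by (rule lborel_pair.Fubini') measurable
  also have "\<dots> = (\<integral>\<^sup>+s. ennreal (Gamma (1 - \<beta>)) * ennreal (indicator {0..z} s * (c + s) powr (\<beta> - 1)) \<partial>lborel)"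
  proof (rule nn_integral_cong_AE)
    show "AE s in lborel. (\<integral>\<^sup>+t. ?h s t \<partial>lborel) =
        ennreal (Gamma (1 - \<beta>)) * ennreal (indicator {0..z} s * (c + s) powr (\<beta> - 1))"
      using AE_lborel_singleton[of "0::real"] by eventually_elim (rule inner_t)
  qed
  also have "\<dots> = ennreal (Gamma (1 - \<beta>)) * ennreal (((z + c) powr \<beta> - c powr \<beta>) / \<beta>)"
    by (subst nn_integral_cmult) (auto simp: J)
  also have "\<dots> = ennreal (Gamma (1 - \<beta>) / \<beta> * ((z + c) powr \<beta> - c powr \<beta>))"
    using c z \<beta> by (subst ennreal_mult[symmetric]) (auto simp: Gamma_real_nonneg intro!: divide_nonneg_pos powr_mono2)
  finally show ?thesis
    unfolding inner_s .
qed

text \<open>Writes the subtracted m as \<open>c powr \<beta>\<close> with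
  \<open>c = m powr (2 / \<alpha>)\<close> and \<open>\<beta> = \<alpha> / 2\<close>, the increment
  form that subordination produces.\<close>

lemma Phi_eq:
  assumes "0 < \<alpha>" "0 \<le> m"
  shows "Phi m \<alpha> z = (z + m powr (2 / \<alpha>)) powr (\<alpha> / 2) - (m powr (2 / \<alpha>)) powr (\<alpha> / 2)"
  using assms by (simp add: Phi_def powr_powr)

lemma Phi_bounds:
  assumes "0 < \<alpha>" "\<alpha> < 2" "0 \<le> m" "0 \<le> z"
  shows "0 \<le> Phi m \<alpha> z" "Phi m \<alpha> z \<le> 1 + m powr (2 / \<alpha>) + z"
proof -
  show "0 \<le> Phi m \<alpha> z"
    using assms unfolding Phi_eq[OF assms(1,3)] by (auto intro!: powr_mono2)
  \<comment> \<open>Adding 1 makes the base at least 1, so the exponent \<open>\<alpha> / 2\<close>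
    may be raised to 1. Linear growth in z is quadratic growth in the frequency.\<close>
  have "(z + m powr (2 / \<alpha>)) powr (\<alpha> / 2) \<le> (1 + (z + m powr (2 / \<alpha>))) powr (\<alpha> / 2)"
    using assms by (intro powr_mono2) auto
  also have "\<dots> \<le> (1 + (z + m powr (2 / \<alpha>))) powr 1"
    using assms by (intro powr_mono) auto
  finally show "Phi m \<alpha> z \<le> 1 + m powr (2 / \<alpha>) + z"
    using assms by (simp add: Phi_def)
qed

text \<open>
  Testing the multiplier against a Gaussian on the Fourier side turns it, by subordination, into a
  superposition of differences of heat flows; in particular no transform of the non-smooth symbol occurs.
\<close>

lemma multiplier_pairing_le:
  fixes e p :: "'a::euclidean_space"
  assumes fg: "(f, g) \<in> fourier_multiplier (\<lambda>y. Phi m \<alpha> ((norm y)\<^sup>2))"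
    and \<alpha>: "0 < \<alpha>" "\<alpha> < 2" and m: "0 \<le> m" and e: "e \<in> Basis" and r: "0 < r"
  defines "Q \<equiv> \<lambda>r. \<integral>x. f x * of_real (heat_dipole e r (x - p)) \<partial>lborel"
  shows "ennreal (Gamma (1 - \<alpha> / 2) / (\<alpha> / 2) * norm (\<integral>x. g x * of_real (heat_dipole e r (x - p)) \<partial>lborel))
    \<le> (\<integral>\<^sup>+t. ennreal (indicator {0<..} t * (t powr (- 1 - \<alpha> / 2) * norm (Q r - Q (r + 2 * t)))) \<partial>lborel)"
proof -
  define c where "c = m powr (2 / \<alpha>)"
  define \<kappa> where "\<kappa> = Gamma (1 - \<alpha> / 2) / (\<alpha> / 2)"
  define K :: "'a \<Rightarrow> real \<Rightarrow> real" where
    "K y t = indicator {0<..} t * (exp (- (t * c)) * (1 - exp (- (t * (norm y)\<^sup>2))) * t powr (- 1 - \<alpha> / 2))" for y t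
  let ?\<mu> = "\<lambda>y::'a. Phi m \<alpha> ((norm y)\<^sup>2)"
  let ?w = "\<lambda>r. modulated_gauss e r p"
  obtain F G where FG: "plancherel f F" "plancherel g G" "AE y in lborel. G y = of_real (?\<mu> y) * F y"
    using fg by (auto simp: fourier_multiplier_def)
  have F: "F \<in> L2_space" and G: "G \<in> L2_space"
    using FG by (auto simp: plancherel_def)
  have \<kappa>: "0 \<le> \<kappa>"
    using \<alpha> by (simp add: \<kappa>_def Gamma_real_nonneg)
  have [measurable]: "F \<in> borel_measurable borel" "G \<in> borel_measurable borel"
    using F G by (auto dest: L2_space_measurable)
  have [measurable]: "(\<lambda>y. K y t) \<in> borel_measurable borel" "K y \<in> borel_measurable borel" for y t
    unfolding K_def[abs_def] by measurable
  have [measurable]: "?\<mu> \<in> borel_measurable borel"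
    unfolding Phi_def[abs_def] by measurable
  have K_nonneg: "0 \<le> K y t" for y t
    by (auto simp: K_def indicator_def)
  have K: "integrable lborel (K y)" "integral\<^sup>L lborel (K y) = \<kappa> * ?\<mu> y" for y
  proof -
    have nn: "(\<integral>\<^sup>+t. ennreal (K y t) \<partial>lborel) = ennreal (\<kappa> * ?\<mu> y)"
      unfolding K_def \<kappa>_def Phi_eq[OF \<alpha>(1) m] c_def[symmetric]
      using \<alpha> by (intro nn_integral_subordination) (auto simp: c_def)
    show "integrable lborel (K y)"
      by (rule integrableI_nonneg) (simp_all add: K_nonneg nn)
    show "integral\<^sup>L lborel (K y) = \<kappa> * ?\<mu> y"
      using \<kappa> Phi_bounds(1)[OF \<alpha> m, of "(norm y)\<^sup>2"]
      by (subst integral_eq_nn_integral) (auto simp: K_nonneg nn)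
  qed
  have dip_L2: "(\<lambda>x. - \<i> * of_real (heat_dipole e s (x - p))) \<in> L2_space" if "0 < s" for s
    using lborel_affine_integrable_iff[of "\<lambda>u. (heat_dipole e s u)\<^sup>2" 1 "- p"] heat_dipole_L2[OF e that]
    by (simp add: L2_space_def norm_mult)
  \<comment> \<open>The transforms F and G are compared with f and g only through these pairings
    with Gaussians: for f at the scales r and \<open>r + 2 * t\<close>, for g at r.\<close>
  have pair: "(\<integral>y. H y * ?w s y \<partial>lborel) = - \<i> * (\<integral>x. h x * of_real (heat_dipole e s (x - p)) \<partial>lborel)"
    if "plancherel h H" "0 < s" for h H s
  proof -
    have *: "fourier_L1 (?w s) = (\<lambda>x. - \<i> * of_real (heat_dipole e s (x - p)))"
      using fourier_L1_modulated_gauss[OF e that(2)] by auto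
    have "(\<integral>y. H y * ?w s y \<partial>lborel) = (\<integral>x. h x * fourier_L1 (?w s) x \<partial>lborel)"
      using that e dip_L2[OF that(2)]
      by (intro plancherel_parseval modulated_gauss_integrable modulated_gauss_weighted_L2) (auto simp: *)
    also have "\<dots> = (\<integral>x. - \<i> * (h x * of_real (heat_dipole e s (x - p))) \<partial>lborel)"
      unfolding * by (simp only: mult.left_commute)
    finally show ?thesis
      by simp
  qed
  have Fw: "integrable lborel (\<lambda>y. F y * ?w s y)" if "0 < s" for s
    using L2_space_mult_integrable[OF F modulated_gauss_weighted_L2(2)[OF e that]] .
  \<comment> \<open>The absolute integrability behind the exchange of the t and y integrals; the
    quadratically weighted Gaussian is in L2 for this purpose.\<close>
  have F\<mu>w: "integrable lborel (\<lambda>y. \<kappa> * ?\<mu> y * norm (F y * ?w r y))"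
  proof (rule Bochner_Integration.integrable_bound)
    show "integrable lborel (\<lambda>y. \<kappa> * ((1 + c) * norm (F y * ?w r y) + norm (F y * (of_real ((norm y)\<^sup>2) * ?w r y))))"
      using Fw[OF r] L2_space_mult_integrable[OF F modulated_gauss_weighted_L2(1)[OF e r]]
      by (intro integrable_mult_right Bochner_Integration.integrable_add integrable_norm)
    have *: "\<bar>?\<mu> y\<bar> \<le> 1 + c + (norm y)\<^sup>2" for y
      using Phi_bounds[OF \<alpha> m, of "(norm y)\<^sup>2"] by (simp add: c_def)
    have "norm (\<kappa> * ?\<mu> y * norm (F y * ?w r y)) = \<kappa> * (\<bar>?\<mu> y\<bar> * norm (F y * ?w r y))" for y
      using \<kappa> by (simp add: abs_mult)
    also have "\<kappa> * (\<bar>?\<mu> y\<bar> * norm (F y * ?w r y)) \<le> \<kappa> * ((1 + c + (norm y)\<^sup>2) * norm (F y * ?w r y))" for y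
      using * \<kappa> by (intro mult_left_mono mult_right_mono) auto
    also have "(1 + c + (norm y)\<^sup>2) * norm (F y * ?w r y) =
        (1 + c) * norm (F y * ?w r y) + norm (F y * (of_real ((norm y)\<^sup>2) * ?w r y))" for y
      by (simp add: norm_mult algebra_simps del: of_real_power)
    finally have bound: "norm (\<kappa> * ?\<mu> y * norm (F y * ?w r y)) \<le>
        \<kappa> * ((1 + c) * norm (F y * ?w r y) + norm (F y * (of_real ((norm y)\<^sup>2) * ?w r y)))" for y .
    show "AE y in lborel. norm (\<kappa> * ?\<mu> y * norm (F y * ?w r y)) \<le>
        norm (\<kappa> * ((1 + c) * norm (F y * ?w r y) + norm (F y * (of_real ((norm y)\<^sup>2) * ?w r y))))"
      by (intro AE_I2 order_trans[OF bound]) (simp only: real_norm_def abs_ge_self)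
  qed measurable
  let ?H = "\<lambda>y t. of_real (K y t) * (F y * ?w r y)"
  have H: "integrable (lborel \<Otimes>\<^sub>M lborel) (\<lambda>(y, t). ?H y t)"
  proof (rule lborel_pair.Fubini_integrable)
    show "(\<lambda>(y, t). ?H y t) \<in> borel_measurable (lborel \<Otimes>\<^sub>M lborel)"
      unfolding K_def by measurable
    show "AE y in lborel. integrable lborel (\<lambda>t. case (y, t) of (y, t) \<Rightarrow> ?H y t)"
      using K(1) by (auto intro!: AE_I2 integrable_mult_left integrable_of_real)
    have "(\<integral>t. norm (?H y t) \<partial>lborel) = \<kappa> * ?\<mu> y * norm (F y * ?w r y)" for y
      using K(2)[of y] K_nonneg by (simp add: norm_mult)
    then show "integrable lborel (\<lambda>y. \<integral>t. norm (case (y, t) of (y, t) \<Rightarrow> ?H y t) \<partial>lborel)"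
      using F\<mu>w by simp
  qed
  have H_t: "(\<integral>y. ?H y t \<partial>lborel) =
      of_real (indicator {0<..} t * (exp (- (t * c)) * t powr (- 1 - \<alpha> / 2))) * (- \<i> * (Q r - Q (r + 2 * t)))" for t
  proof (cases "0 < t")
    case True
    let ?k = "complex_of_real (exp (- (t * c)) * t powr (- 1 - \<alpha> / 2))"
    have "?w r y - ?w (r + 2 * t) y = of_real (1 - exp (- (t * (norm y)\<^sup>2))) * ?w r y" for y
    proof -
      \<comment> \<open>Multiplication by \<open>exp (- (t * (norm y)\<^sup>2))\<close> raises the
        variance by \<open>2 * t\<close>, which is where the second scale comes from.\<close>
      have "- (r + 2 * t) * (norm y)\<^sup>2 / 2 = - r * (norm y)\<^sup>2 / 2 + - (t * (norm y)\<^sup>2)"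
        by (simp add: field_simps)
      then show ?thesis
        unfolding modulated_gauss_def by (simp only: exp_add) (simp add: algebra_simps)
    qed
    then have "?H y t = ?k * (F y * ?w r y - F y * ?w (r + 2 * t) y)" for y
      using True by (simp add: K_def mult_ac flip: right_diff_distrib)
    then have "(\<integral>y. ?H y t \<partial>lborel) = ?k * ((\<integral>y. F y * ?w r y \<partial>lborel) - (\<integral>y. F y * ?w (r + 2 * t) y \<partial>lborel))"
      using Fw[OF r] Fw[of "r + 2 * t"] r True by simp
    also have "(\<integral>y. F y * ?w r y \<partial>lborel) = - \<i> * Q r"
      unfolding Q_def by (rule pair[OF FG(1) r])
    also have "(\<integral>y. F y * ?w (r + 2 * t) y \<partial>lborel) = - \<i> * Q (r + 2 * t)"
      unfolding Q_def by (rule pair[OF FG(1)]) (use r True in simp)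
    finally show ?thesis
      using True by (simp add: right_diff_distrib)
  qed (simp add: K_def)
  have "of_real \<kappa> * (\<integral>y. G y * ?w r y \<partial>lborel) = (\<integral>y. of_real \<kappa> * (G y * ?w r y) \<partial>lborel)"
    by simp
  also have "\<dots> = (\<integral>y. (\<integral>t. ?H y t \<partial>lborel) \<partial>lborel)"
  proof (rule integral_cong_AE)
    show "(\<lambda>y. \<integral>t. ?H y t \<partial>lborel) \<in> borel_measurable lborel"
      unfolding K_def by measurable
    show "AE y in lborel. of_real \<kappa> * (G y * ?w r y) = (\<integral>t. ?H y t \<partial>lborel)"
      using FG(3)
    proof eventually_elim
      case (elim y)
      have "(\<integral>t. ?H y t \<partial>lborel) = of_real (\<kappa> * ?\<mu> y) * (F y * ?w r y)"
        using K[of y] by (simp del: of_real_mult)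
      with elim show ?case
        by auto
    qed
  qed measurable
  also have "\<dots> = (\<integral>t. (\<integral>y. ?H y t \<partial>lborel) \<partial>lborel)"
    by (rule lborel_pair.Fubini_integral[OF H, symmetric])
  finally have eq: "of_real \<kappa> * (- \<i> * (\<integral>x. g x * of_real (heat_dipole e r (x - p)) \<partial>lborel)) =
      (\<integral>t. (\<integral>y. ?H y t \<partial>lborel) \<partial>lborel)"
    unfolding pair[OF FG(2) r] .
  have "ennreal (\<kappa> * norm (\<integral>x. g x * of_real (heat_dipole e r (x - p)) \<partial>lborel)) =
      ennreal (norm (\<integral>t. (\<integral>y. ?H y t \<partial>lborel) \<partial>lborel))"
    using \<kappa> unfolding eq[symmetric] by (simp add: norm_mult)
  also have "\<dots> \<le> (\<integral>\<^sup>+t. norm (\<integral>y. ?H y t \<partial>lborel) \<partial>lborel)"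
    by (rule integral_norm_bound_ennreal) (use lborel_pair.integrable_snd[OF H] in simp)
  also have "\<dots> \<le> (\<integral>\<^sup>+t. ennreal (indicator {0<..} t * (t powr (- 1 - \<alpha> / 2) * norm (Q r - Q (r + 2 * t)))) \<partial>lborel)"
  proof (rule nn_integral_mono)
    fix t :: real
    \<comment> \<open>The mass is discarded here: since c is nonnegative,
      \<open>exp (- (t * c)) \<le> 1\<close>.\<close>
    have "indicator {0<..} t * (exp (- (t * c)) * t powr (- 1 - \<alpha> / 2)) * norm (Q r - Q (r + 2 * t))
        \<le> indicator {0<..} t * (1 * t powr (- 1 - \<alpha> / 2)) * norm (Q r - Q (r + 2 * t))"
      by (cases "0 < t") (auto simp: c_def intro!: mult_left_le_one_le)
    then show "ennreal (norm (\<integral>y. ?H y t \<partial>lborel)) \<le>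
        ennreal (indicator {0<..} t * (t powr (- 1 - \<alpha> / 2) * norm (Q r - Q (r + 2 * t))))"
      unfolding H_t by (intro ennreal_leI) (simp add: norm_mult indicator_def)
  qed
  finally show ?thesis
    by (simp add: \<kappa>_def)
qed

subsection \<open>Variation of heat dipoles in the scale\<close>

lemma heat_dipole_has_derivative:
  fixes e u :: "'a::euclidean_space"
  assumes r: "0 < r"
  shows "((\<lambda>r. heat_dipole e r u) has_real_derivative
    heat_dipole e r u * ((norm u)\<^sup>2 / (2 * r\<^sup>2) - (real DIM('a) / 2 + 1) / r)) (at r)"
proof -
  let ?p = "real DIM('a) / 2 + 1"
  have "((\<lambda>r. (u \<bullet> e) * r powr (- ?p) * exp (- (norm u)\<^sup>2 / (2 * r))) has_real_derivative
    (u \<bullet> e) * ((- ?p) * r powr (- ?p - 1)) * exp (- (norm u)\<^sup>2 / (2 * r)) +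
    (u \<bullet> e) * r powr (- ?p) * (exp (- (norm u)\<^sup>2 / (2 * r)) * ((norm u)\<^sup>2 / (2 * r\<^sup>2)))) (at r)"
    using r by (auto intro!: derivative_eq_intros simp: field_simps power2_eq_square)
  moreover have "r powr (- ?p - 1) = r powr (- ?p) / r"
    using r powr_diff[of r "- ?p" 1] by (simp only: powr_one less_imp_le)
  ultimately show ?thesis
    unfolding heat_dipole_def by (simp add: algebra_simps add_divide_distrib)
qed

text \<open>Mean value theorem in the scale. The two terms of the logarithmic derivative have
  opposite signs, and their difference is bounded by their sum.\<close>

lemma heat_dipole_diff_le:
  fixes e u :: "'a::euclidean_space"
  assumes r: "0 < r" and t: "0 \<le> t"
    and B: "\<And>\<rho>. r \<le> \<rho> \<Longrightarrow> \<rho> \<le> r + 2 * t \<Longrightarrow>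
      \<bar>heat_dipole e \<rho> u\<bar> * ((norm u)\<^sup>2 / (2 * \<rho>\<^sup>2) + (real DIM('a) / 2 + 1) / \<rho>) \<le> B"
  shows "\<bar>heat_dipole e r u - heat_dipole e (r + 2 * t) u\<bar> \<le> 2 * t * B"
proof (cases "t = 0")
  case False
  with t have "r < r + 2 * t" by simp
  have der: "((\<lambda>r. heat_dipole e r u) has_real_derivative
      heat_dipole e \<rho> u * ((norm u)\<^sup>2 / (2 * \<rho>\<^sup>2) - (real DIM('a) / 2 + 1) / \<rho>)) (at \<rho>)"
    if "r \<le> \<rho>" "\<rho> \<le> r + 2 * t" for \<rho>
    using that r by (intro heat_dipole_has_derivative) simp
  from MVT2[OF \<open>r < r + 2 * t\<close> der] obtain \<rho> where \<rho>: "r < \<rho>" "\<rho> < r + 2 * t"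
    and eq: "heat_dipole e (r + 2 * t) u - heat_dipole e r u =
      (r + 2 * t - r) * (heat_dipole e \<rho> u * ((norm u)\<^sup>2 / (2 * \<rho>\<^sup>2) - (real DIM('a) / 2 + 1) / \<rho>))"
    by blast
  have "\<bar>(norm u)\<^sup>2 / (2 * \<rho>\<^sup>2) - (real DIM('a) / 2 + 1) / \<rho>\<bar> \<le>
      (norm u)\<^sup>2 / (2 * \<rho>\<^sup>2) + (real DIM('a) / 2 + 1) / \<rho>"
    using \<rho> r abs_triangle_ineq4[of "(norm u)\<^sup>2 / (2 * \<rho>\<^sup>2)" "(real DIM('a) / 2 + 1) / \<rho>"] by simp
  then have "\<bar>heat_dipole e \<rho> u\<bar> * \<bar>(norm u)\<^sup>2 / (2 * \<rho>\<^sup>2) - (real DIM('a) / 2 + 1) / \<rho>\<bar> \<le> B"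
    using \<rho> by (intro order_trans[OF mult_left_mono B]) auto
  then have "2 * t * (\<bar>heat_dipole e \<rho> u\<bar> * \<bar>(norm u)\<^sup>2 / (2 * \<rho>\<^sup>2) - (real DIM('a) / 2 + 1) / \<rho>\<bar>) \<le> 2 * t * B"
    using t by (intro mult_left_mono) auto
  then show ?thesis
    using eq t by (simp add: abs_mult abs_minus_commute[of "heat_dipole e r u"])
qed simp

text \<open>In terms of the Gaussian exponent \<open>x = (norm u)\<^sup>2 / (2 * r)\<close>, the
  dipole and its derivative in the scale are bounded by powers of x times \<open>exp (- x)\<close>,
  with nonpositive powers of \<open>norm u\<close> that are at most 1 outside the unit ball. Hence
  the bounds are uniform in r. The factor \<open>min t 1\<close> comes from the derivative for small
  t and from the two dipoles separately for large t; it is integrable against the subordination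
  weight.\<close>

lemma heat_dipole_outside_bound:
  fixes e :: "'a::euclidean_space"
  assumes e: "e \<in> Basis"
  obtains K where "0 \<le> K"
    "\<And>r u. 0 < r \<Longrightarrow> 1 \<le> norm u \<Longrightarrow> \<bar>heat_dipole e r u\<bar> \<le> K"
    "\<And>r t u. 0 < r \<Longrightarrow> 0 \<le> t \<Longrightarrow> 1 \<le> norm u \<Longrightarrow>
      \<bar>heat_dipole e r u - heat_dipole e (r + 2 * t) u\<bar> \<le> K * min t 1"
proof -
  define p where "p = real DIM('a) / 2 + 1"
  have p: "1 \<le> p" by (simp add: p_def)
  obtain K0 where K0: "0 \<le> K0" "\<And>x. 0 \<le> x \<Longrightarrow> x powr p \<le> K0 * exp x"
    using powr_le_const_mult_exp[of p] p by auto
  obtain K1 where K1: "0 \<le> K1" "\<And>x. 0 \<le> x \<Longrightarrow> x powr (p + 1) \<le> K1 * exp x"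
    using powr_le_const_mult_exp[of "p + 1"] p by auto
  obtain K2 where K2: "0 \<le> K2" "\<And>x. 0 \<le> x \<Longrightarrow> x powr (p + 2) \<le> K2 * exp x"
    using powr_le_const_mult_exp[of "p + 2"] p by auto
  define A where "A = 2 powr p * K0"
  define B where "B = 2 powr p * 2 * (K2 + p * K1)"
  have AB: "0 \<le> A" "0 \<le> B"
    using K0 K1 K2 p by (auto simp: A_def B_def)
  have core: "\<bar>heat_dipole e r u\<bar> \<le> A \<and>
      \<bar>heat_dipole e r u\<bar> * ((norm u)\<^sup>2 / (2 * r\<^sup>2) + p / r) \<le> B"
    if r: "0 < r" and u: "1 \<le> norm u" for r and u :: 'a
  proof -
    define x where "x = (norm u)\<^sup>2 / (2 * r)"
    have x: "0 < x" using r u by (auto simp: x_def intro!: divide_pos_pos)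
    have req: "r = (norm u)\<^sup>2 / (2 * x)" using r u by (auto simp: x_def field_simps)
    have "r powr (- p) = 2 powr p * x powr p * ((norm u)\<^sup>2) powr (- p)"
      unfolding req using x u by (simp add: powr_divide powr_mult powr_minus field_simps)
    moreover have "((norm u)\<^sup>2) powr (- p) * norm u \<le> 1"
    proof -
      have "((norm u)\<^sup>2) powr (- p) = (norm u powr 2) powr (- p)"
        by simp
      then have "((norm u)\<^sup>2) powr (- p) * norm u = norm u powr (- 2 * p) * norm u powr 1"
        by (simp only: powr_powr) simp
      also have "\<dots> = norm u powr (- 2 * p + 1)"
        by (simp only: powr_add)
      also have "\<dots> \<le> norm u powr 0"
        using u p by (intro powr_mono) auto
      also have "\<dots> = 1"
        using u by auto
      finally show ?thesis .
    qed
    ultimately have "r powr (- p) * norm u \<le> 2 powr p * x powr p"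
      using mult_left_mono[of "((norm u)\<^sup>2) powr (- p) * norm u" 1 "2 powr p * x powr p"] by (simp add: mult.assoc)
    then have "r powr (- p) * norm u * exp (- x) \<le> 2 powr p * x powr p * exp (- x)"
      by (rule mult_right_mono) simp
    moreover have "\<bar>heat_dipole e r u\<bar> \<le> r powr (- p) * norm u * exp (- x)"
      using heat_dipole_abs_le[OF e, of r u] unfolding p_def[symmetric] by (simp add: x_def mult.assoc)
    ultimately have d: "\<bar>heat_dipole e r u\<bar> \<le> 2 powr p * x powr p * exp (- x)"
      by linarith
    have ex: "y * exp (- x) \<le> k" if "y \<le> k * exp x" for y k :: real
      using mult_right_mono[OF that, of "exp (- x)"] by (simp add: mult.assoc flip: exp_add)
    have "\<bar>heat_dipole e r u\<bar> \<le> 2 powr p * (x powr p * exp (- x))"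
      using d by (simp add: mult.assoc)
    also have "\<dots> \<le> A"
      unfolding A_def using x K0(2)[of x] by (intro mult_left_mono ex) auto
    finally have 1: "\<bar>heat_dipole e r u\<bar> \<le> A" .
    have inv: "1 / r = 2 * x / (norm u)\<^sup>2"
      using r u by (auto simp: x_def)
    have "(norm u)\<^sup>2 / (2 * r\<^sup>2) + p / r = (x + p) * (1 / r)"
      using r by (simp add: x_def power2_eq_square field_simps)
    also have "\<dots> = (x + p) * (2 * x) / (norm u)\<^sup>2"
      unfolding inv by simp
    also have "\<dots> \<le> (x + p) * (2 * x) / 1"
      using x u p by (intro divide_left_mono) auto
    finally have "\<bar>heat_dipole e r u\<bar> * ((norm u)\<^sup>2 / (2 * r\<^sup>2) + p / r) \<le>
        (2 powr p * x powr p * exp (- x)) * ((x + p) * (2 * x))"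
      using d x p r by (intro mult_mono) auto
    also have "\<dots> = 2 powr p * 2 * (x powr (p + 2) * exp (- x) + p * (x powr (p + 1) * exp (- x)))"
      using x by (simp add: powr_add power2_eq_square algebra_simps)
    also have "\<dots> \<le> B"
      unfolding B_def using x K1(2)[of x] K2(2)[of x] p by (intro mult_left_mono add_mono ex) auto
    finally show ?thesis
      using 1 by simp
  qed
  have diff: "\<bar>heat_dipole e r u - heat_dipole e (r + 2 * t) u\<bar> \<le> (2 * A + 2 * B) * min t 1"
    if r: "0 < r" and t: "0 \<le> t" and u: "1 \<le> norm u" for r t and u :: 'a
  proof (cases "t \<le> 1")
    case True
    have "\<bar>heat_dipole e r u - heat_dipole e (r + 2 * t) u\<bar> \<le> 2 * t * B"
      using core u r unfolding p_def by (intro heat_dipole_diff_le[OF r t]) auto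
    also have "\<dots> \<le> (2 * A + 2 * B) * min t 1"
      using True t AB by (simp add: distrib_right)
    finally show ?thesis .
  next
    case False
    then have "\<bar>heat_dipole e r u\<bar> \<le> A" "\<bar>heat_dipole e (r + 2 * t) u\<bar> \<le> A"
      using core[of r u] core[of "r + 2 * t" u] u r by auto
    then show ?thesis
      using False AB by simp
  qed
  show ?thesis
  proof (rule that[of "2 * A + 2 * B"])
    show "\<bar>heat_dipole e r u\<bar> \<le> 2 * A + 2 * B" if "0 < r" "1 \<le> norm u" for r u
      using core[OF that] AB by simp
  qed (use AB diff in auto)
qed

text \<open>The power of the norm contributes \<open>s / 2\<close> to the exponent and the dipole
  contributes \<open>- 1 / 2\<close>. The coefficients a and b allow both a difference of dipoles
  and, with \<open>b = 0\<close>, a single one.\<close>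

lemma heat_dipole_moment_scale:
  fixes e :: "'a::euclidean_space"
  assumes r: "0 < r" and k: "0 < k" "0 < k'"
  shows "(\<integral>u. norm u powr s * \<bar>a * heat_dipole e (k * r) u - b * heat_dipole e (k' * r) u\<bar> \<partial>lborel)
    = r powr ((s - 1) / 2) * (\<integral>w. norm w powr s * \<bar>a * heat_dipole e k w - b * heat_dipole e k' w\<bar> \<partial>lborel)"
proof -
  let ?q = "r powr (- (real DIM('a) + 1) / 2)"
  have "(\<integral>u. norm u powr s * \<bar>a * heat_dipole e (k * r) u - b * heat_dipole e (k' * r) u\<bar> \<partial>lborel) =
    sqrt r ^ DIM('a) * (\<integral>w. norm (sqrt r *\<^sub>R w) powr s *
      \<bar>a * heat_dipole e (k * r) (sqrt r *\<^sub>R w) - b * heat_dipole e (k' * r) (sqrt r *\<^sub>R w)\<bar> \<partial>lborel)"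
    using r by (subst lborel_affine_integral[of _ "sqrt r" 0]) auto
  also have "(\<lambda>w. norm (sqrt r *\<^sub>R w) powr s *
      \<bar>a * heat_dipole e (k * r) (sqrt r *\<^sub>R w) - b * heat_dipole e (k' * r) (sqrt r *\<^sub>R w)\<bar>) =
    (\<lambda>w. (r powr (s / 2) * ?q) * (norm w powr s * \<bar>a * heat_dipole e k w - b * heat_dipole e k' w\<bar>))"
  proof
    fix w :: 'a
    have "norm (sqrt r *\<^sub>R w) powr s = r powr (s / 2) * norm w powr s"
      using r by (simp add: powr_mult powr_half_sqrt[symmetric] powr_powr)
    moreover have "\<bar>a * heat_dipole e (k * r) (sqrt r *\<^sub>R w) - b * heat_dipole e (k' * r) (sqrt r *\<^sub>R w)\<bar>
        = ?q * \<bar>a * heat_dipole e k w - b * heat_dipole e k' w\<bar>"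
    proof -
      have "a * heat_dipole e (k * r) (sqrt r *\<^sub>R w) - b * heat_dipole e (k' * r) (sqrt r *\<^sub>R w)
         = ?q * (a * heat_dipole e k w - b * heat_dipole e k' w)"
        unfolding heat_dipole_scale[OF r k(1)] heat_dipole_scale[OF r k(2)] by (simp add: algebra_simps)
      then show ?thesis
        by (simp add: abs_mult)
    qed
    ultimately show "norm (sqrt r *\<^sub>R w) powr s *
      \<bar>a * heat_dipole e (k * r) (sqrt r *\<^sub>R w) - b * heat_dipole e (k' * r) (sqrt r *\<^sub>R w)\<bar> =
      (r powr (s / 2) * ?q) * (norm w powr s * \<bar>a * heat_dipole e k w - b * heat_dipole e k' w\<bar>)"
      by simp
  qed
  also have "sqrt r ^ DIM('a) * (\<integral>w. (r powr (s / 2) * ?q) * (norm w powr s * \<bar>a * heat_dipole e k w - b * heat_dipole e k' w\<bar>) \<partial>lborel)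
     = (sqrt r ^ DIM('a) * (r powr (s / 2) * ?q)) * (\<integral>w. norm w powr s * \<bar>a * heat_dipole e k w - b * heat_dipole e k' w\<bar> \<partial>lborel)"
    unfolding integral_mult_right_zero by simp
  also have "sqrt r ^ DIM('a) * (r powr (s / 2) * ?q) = r powr ((s - 1) / 2)"
    using r by (simp add: powr_half_sqrt[symmetric] powr_power add_divide_distrib diff_divide_distrib flip: powr_add)
  finally show ?thesis .
qed

text \<open>For small t the derivative in the scale gives a bound linear in t. For large t there is
  no cancellation: the moment at scale \<open>1 + 2 * t\<close> is of order
  \<open>t powr ((s - 1) / 2)\<close>, while the one at scale 1 is constant, so the growth exponent
  \<open>\<gamma>\<close> has to be nonnegative even when \<open>s < 1\<close>.\<close>

lemma heat_dipole_unit_diff_moment: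
  fixes e :: "'a::euclidean_space"
  assumes e: "e \<in> Basis" and s: "0 \<le> s" and \<gamma>: "0 \<le> \<gamma>" "\<gamma> \<le> 1" "(s - 1) / 2 \<le> \<gamma>"
  obtains K where "0 \<le> K" "\<And>t. 0 < t \<Longrightarrow>
    (\<integral>w. norm w powr s * \<bar>heat_dipole e 1 w - heat_dipole e (1 + 2 * t) w\<bar> \<partial>lborel) \<le> K * min t (t powr \<gamma>)"
proof -
  let ?p = "real DIM('a) / 2 + 1"
  define M0 where "M0 = (\<integral>w. norm w powr s * \<bar>heat_dipole e 1 w\<bar> \<partial>lborel)"
  \<comment> \<open>\<open>norm w powr s\<close> times a bound of the derivative for all scales
    between 1 and 2; the \<open>1 / 4\<close> is \<open>1 / (2 * \<rho>)\<close> at the largest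
    scale \<open>\<rho> = 2\<close>, reached for \<open>t = 1 / 2\<close>.\<close>
  define h :: "'a \<Rightarrow> real" where
    "h w = norm w powr (s + 3) * exp (- (1 / 4) * (norm w)\<^sup>2) + ?p * (norm w powr (s + 1) * exp (- (1 / 4) * (norm w)\<^sup>2))" for w
  define M1 where "M1 = integral\<^sup>L lborel h"
  have h: "integrable lborel h"
    unfolding h_def[abs_def] using s
    by (intro Bochner_Integration.integrable_add integrable_mult_right integrable_gauss_moment) auto
  have M: "0 \<le> M0" "0 \<le> M1"
    by (auto simp: M0_def M1_def h_def intro!: integral_nonneg_AE)
  have small: "(\<integral>w. norm w powr s * \<bar>heat_dipole e 1 w - heat_dipole e (1 + 2 * t) w\<bar> \<partial>lborel) \<le> 2 * t * M1"
    if t: "0 < t" "t \<le> 1 / 2" for t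
  proof -
    have le: "norm w powr s * \<bar>heat_dipole e 1 w - heat_dipole e (1 + 2 * t) w\<bar> \<le> 2 * t * h w" for w
    proof -
      let ?E = "norm w * exp (- (1 / 4) * (norm w)\<^sup>2)"
      have "\<bar>heat_dipole e 1 w - heat_dipole e (1 + 2 * t) w\<bar> \<le> 2 * t * (?E * ((norm w)\<^sup>2 + ?p))"
      proof (rule heat_dipole_diff_le)
        fix \<rho> :: real assume \<rho>: "1 \<le> \<rho>" "\<rho> \<le> 1 + 2 * t"
        have "\<bar>heat_dipole e \<rho> w\<bar> \<le> \<rho> powr (- ?p) * (norm w powr 1 * exp (- (norm w)\<^sup>2 / (2 * \<rho>)))"
          by (rule heat_dipole_abs_le[OF e])
        also have "\<dots> \<le> 1 * (norm w powr 1 * exp (- (1 / 4) * (norm w)\<^sup>2))"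
        proof (intro mult_mono)
          show "\<rho> powr (- ?p) \<le> 1"
            using powr_mono[of "- ?p" 0 \<rho>] \<rho> by simp
          have "(norm w)\<^sup>2 / 4 \<le> (norm w)\<^sup>2 / (2 * \<rho>)"
            using \<rho> t by (intro divide_left_mono) auto
          then show "exp (- (norm w)\<^sup>2 / (2 * \<rho>)) \<le> exp (- (1 / 4) * (norm w)\<^sup>2)"
            by simp
        qed auto
        finally have 1: "\<bar>heat_dipole e \<rho> w\<bar> \<le> ?E"
          by simp
        have "1 \<le> 2 * \<rho>\<^sup>2"
          using one_le_power[OF \<rho>(1), of 2] by linarith
        then have "(norm w)\<^sup>2 / (2 * \<rho>\<^sup>2) \<le> (norm w)\<^sup>2 / 1"
          using \<rho> by (intro divide_left_mono) simp_all
        moreover have "?p / \<rho> \<le> ?p / 1"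
          using \<rho> by (intro divide_left_mono) auto
        ultimately have "(norm w)\<^sup>2 / (2 * \<rho>\<^sup>2) + ?p / \<rho> \<le> (norm w)\<^sup>2 + ?p"
          by simp
        with 1 show "\<bar>heat_dipole e \<rho> w\<bar> * ((norm w)\<^sup>2 / (2 * \<rho>\<^sup>2) + ?p / \<rho>) \<le> ?E * ((norm w)\<^sup>2 + ?p)"
          using \<rho> by (intro mult_mono) auto
      qed (use t in auto)
      then have "norm w powr s * \<bar>heat_dipole e 1 w - heat_dipole e (1 + 2 * t) w\<bar> \<le>
          norm w powr s * (2 * t * (?E * ((norm w)\<^sup>2 + ?p)))"
        by (rule mult_left_mono) simp
      also have "\<dots> = 2 * t * h w"
        by (simp add: h_def powr_add power2_eq_square power3_eq_cube algebra_simps)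
      finally show ?thesis .
    qed
    have i: "integrable lborel (\<lambda>w. 2 * t * h w)"
      using h by simp
    have "(\<integral>w. norm w powr s * \<bar>heat_dipole e 1 w - heat_dipole e (1 + 2 * t) w\<bar> \<partial>lborel) \<le> (\<integral>w. 2 * t * h w \<partial>lborel)"
      using le t by (intro integral_mono' i) (auto simp: h_def)
    then show ?thesis
      by (simp add: M1_def)
  qed
  have large: "(\<integral>w. norm w powr s * \<bar>heat_dipole e 1 w - heat_dipole e (1 + 2 * t) w\<bar> \<partial>lborel) \<le> 8 * M0 * t powr \<gamma>"
    if t: "1 / 2 \<le> t" for t
  proof -
    have i: "integrable lborel (\<lambda>w. norm w powr s * \<bar>heat_dipole e k w\<bar>)" if "0 < k" for k
      using integrable_heat_dipole_moment[OF e that s] .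
    have "(\<integral>w. norm w powr s * \<bar>heat_dipole e 1 w - heat_dipole e (1 + 2 * t) w\<bar> \<partial>lborel) \<le>
        (\<integral>w. norm w powr s * \<bar>heat_dipole e 1 w\<bar> + norm w powr s * \<bar>heat_dipole e (1 + 2 * t) w\<bar> \<partial>lborel)"
      using i[of 1] i[of "1 + 2 * t"] t
      by (intro integral_mono' Bochner_Integration.integrable_add)
        (auto simp flip: distrib_left intro!: mult_left_mono abs_triangle_ineq4)
    also have "\<dots> = M0 + (\<integral>w. norm w powr s * \<bar>heat_dipole e (1 + 2 * t) w\<bar> \<partial>lborel)"
      using i[of 1] i[of "1 + 2 * t"] t by (simp add: M0_def)
    also have "(\<integral>w. norm w powr s * \<bar>heat_dipole e (1 + 2 * t) w\<bar> \<partial>lborel) = (1 + 2 * t) powr ((s - 1) / 2) * M0"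
      using heat_dipole_moment_scale[of "1 + 2 * t" 1 1 s 1 e 0] t by (simp add: M0_def)
    also have "(1 + 2 * t) powr ((s - 1) / 2) \<le> (1 + 2 * t) powr \<gamma>"
      using t \<gamma> by (intro powr_mono) auto
    also have "(1 + 2 * t) powr \<gamma> \<le> (4 * t) powr \<gamma>"
      using t \<gamma> by (intro powr_mono2) auto
    also have "(4 * t) powr \<gamma> \<le> 4 * t powr \<gamma>"
      using powr_mono[of \<gamma> 1 4] \<gamma> t by (simp add: powr_mult)
    also have "M0 + 4 * t powr \<gamma> * M0 \<le> 8 * M0 * t powr \<gamma>"
    proof -
      have "1 \<le> (2 * t) powr \<gamma>"
        using t \<gamma> by (intro ge_one_powr_ge_zero) auto
      also have "\<dots> \<le> 2 * t powr \<gamma>"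
        using powr_mono[of \<gamma> 1 2] \<gamma> t by (simp add: powr_mult)
      finally have "M0 * 1 \<le> M0 * (2 * t powr \<gamma>)"
        using M by (intro mult_left_mono) auto
      moreover have "0 \<le> M0 * t powr \<gamma>"
        using M by simp
      ultimately show ?thesis
        by (simp add: mult_ac)
    qed
    finally show ?thesis
      using M by (simp add: mult_right_mono)
  qed
  show ?thesis
  \<comment> \<open>The 16 is twice the 8 of \<open>large\<close>: beyond \<open>t = 1 / 2\<close>
    the power \<open>t powr \<gamma>\<close> is at most twice
    \<open>min t (t powr \<gamma>)\<close>.\<close>
  proof (rule that[of "2 * M1 + 16 * M0"])
    fix t :: real assume t: "0 < t"
    show "(\<integral>w. norm w powr s * \<bar>heat_dipole e 1 w - heat_dipole e (1 + 2 * t) w\<bar> \<partial>lborel) \<le>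
        (2 * M1 + 16 * M0) * min t (t powr \<gamma>)"
    proof (cases "t \<le> 1 / 2")
      case True
      have "t powr 1 \<le> t powr \<gamma>"
        using True t \<gamma> by (intro powr_mono') auto
      then have "2 * t * M1 \<le> (2 * M1 + 16 * M0) * min t (t powr \<gamma>)"
        using t M by (simp add: distrib_right)
      with small[OF t True] show ?thesis
        by linarith
    next
      case False
      have "t powr \<gamma> \<le> 2 * t"
      proof (cases "t \<le> 1")
        case True
        then have "t powr \<gamma> \<le> 1"
          using powr_mono2[of \<gamma> t 1] t \<gamma> by simp
        with False show ?thesis by simp
      next
        case False
        then have "t powr \<gamma> \<le> t powr 1"
          using \<gamma> by (intro powr_mono) auto
        with False show ?thesis by simp
      qed
      then have "t powr \<gamma> \<le> 2 * min t (t powr \<gamma>)"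
        by (simp add: min_def)
      then have "8 * M0 * t powr \<gamma> \<le> 8 * M0 * (2 * min t (t powr \<gamma>))"
        using M by (intro mult_left_mono) auto
      also have "\<dots> \<le> (2 * M1 + 16 * M0) * min t (t powr \<gamma>)"
        using M t by (simp add: distrib_right)
      finally show ?thesis
        using large[of t] False by linarith
    qed
  qed (use M in simp)
qed

text \<open>Split at \<open>t = r\<close>: below, the linear bound leaves
  \<open>t powr (- \<beta>)\<close>, integrable at 0 since \<open>\<beta> < 1\<close>; above, the
  power bound decays fast enough since \<open>\<gamma> < \<beta>\<close>. By homogeneity both halves
  have order \<open>r powr (- \<beta>)\<close>, which is the price of applying L.\<close>

lemma nn_integral_powr_min_le:
  fixes r \<beta> \<gamma> :: real
  assumes r: "0 < r" and \<gamma>: "0 \<le> \<gamma>" "\<gamma> < \<beta>" and \<beta>: "\<beta> < 1"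
  shows "(\<integral>\<^sup>+t. ennreal (indicator {0<..} t * (t powr (- 1 - \<beta>) * min (t / r) ((t / r) powr \<gamma>))) \<partial>lborel)
    \<le> ennreal ((1 / (1 - \<beta>) + 1 / (\<beta> - \<gamma>)) * r powr (- \<beta>))"
proof -
  have "((\<lambda>t. t powr (- \<beta>)) has_integral (r powr (- \<beta> + 1) / (- \<beta> + 1))) {0..r}"
    using \<beta> r by (intro has_integral_powr_from_0) auto
  from nn_integral_has_integral_lebesgue[OF _ this]
  have I1: "(\<integral>\<^sup>+t. ennreal (indicator {0..r} t * t powr (- \<beta>)) \<partial>lborel) = ennreal (r powr (- \<beta> + 1) / (- \<beta> + 1))"
    by simp
  have "((\<lambda>t. t powr (- 1 - \<beta> + \<gamma>)) has_integral (- (r powr ((- 1 - \<beta> + \<gamma>) + 1)) / ((- 1 - \<beta> + \<gamma>) + 1))) {r..}"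
    using \<gamma> r by (intro has_integral_powr_to_inf) auto
  from nn_integral_has_integral_lebesgue[OF _ this]
  have I2: "(\<integral>\<^sup>+t. ennreal (indicator {r..} t * t powr (- 1 - \<beta> + \<gamma>)) \<partial>lborel) = ennreal (r powr (\<gamma> - \<beta>) / (\<beta> - \<gamma>))"
    by (simp add: minus_divide_right)
  have "(\<integral>\<^sup>+t. ennreal (indicator {0<..} t * (t powr (- 1 - \<beta>) * min (t / r) ((t / r) powr \<gamma>))) \<partial>lborel)
    \<le> (\<integral>\<^sup>+t. ennreal (1 / r) * ennreal (indicator {0..r} t * t powr (- \<beta>)) +
         ennreal (r powr (- \<gamma>)) * ennreal (indicator {r..} t * t powr (- 1 - \<beta> + \<gamma>)) \<partial>lborel)"
  proof (rule nn_integral_mono)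
    fix t :: real
    have "indicator {0<..} t * (t powr (- 1 - \<beta>) * min (t / r) ((t / r) powr \<gamma>)) \<le>
        1 / r * (indicator {0..r} t * t powr (- \<beta>)) + r powr (- \<gamma>) * (indicator {r..} t * t powr (- 1 - \<beta> + \<gamma>))"
    proof (cases "0 < t")
      case True
      then have a: "t powr (- 1 - \<beta>) * (t / r) = 1 / r * t powr (- \<beta>)"
        by (simp add: powr_diff powr_minus field_simps)
      have b: "t powr (- 1 - \<beta>) * (t / r) powr \<gamma> = r powr (- \<gamma>) * t powr (- 1 - \<beta> + \<gamma>)"
        using True r by (simp add: powr_divide powr_minus field_simps flip: powr_add)
      show ?thesis
      proof (cases "t \<le> r")
        case t: True
        have "t powr (- 1 - \<beta>) * min (t / r) ((t / r) powr \<gamma>) \<le> t powr (- 1 - \<beta>) * (t / r)"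
          by (intro mult_left_mono) auto
        with a True t show ?thesis
          by (auto simp: indicator_def intro: add_increasing2)
      next
        case False
        have "t powr (- 1 - \<beta>) * min (t / r) ((t / r) powr \<gamma>) \<le> t powr (- 1 - \<beta>) * (t / r) powr \<gamma>"
          by (intro mult_left_mono) auto
        with b True False show ?thesis
          by (auto simp: indicator_def)
      qed
    qed (use r in \<open>auto simp: indicator_def\<close>)
    then show "ennreal (indicator {0<..} t * (t powr (- 1 - \<beta>) * min (t / r) ((t / r) powr \<gamma>))) \<le>
        ennreal (1 / r) * ennreal (indicator {0..r} t * t powr (- \<beta>)) +
         ennreal (r powr (- \<gamma>)) * ennreal (indicator {r..} t * t powr (- 1 - \<beta> + \<gamma>))"
      using r by (simp add: ennreal_leI flip: ennreal_mult ennreal_plus)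
  qed
  also have "\<dots> = ennreal (1 / r) * ennreal (r powr (- \<beta> + 1) / (- \<beta> + 1)) +
      ennreal (r powr (- \<gamma>)) * ennreal (r powr (\<gamma> - \<beta>) / (\<beta> - \<gamma>))"
    by (subst nn_integral_add) (auto simp: nn_integral_cmult I1 I2)
  also have "\<dots> = ennreal (1 / r * (r powr (- \<beta> + 1) / (- \<beta> + 1)) + r powr (- \<gamma>) * (r powr (\<gamma> - \<beta>) / (\<beta> - \<gamma>)))"
    using r \<beta> \<gamma> by (subst ennreal_plus) (simp_all flip: ennreal_mult)
  also have "1 / r * (r powr (- \<beta> + 1) / (- \<beta> + 1)) + r powr (- \<gamma>) * (r powr (\<gamma> - \<beta>) / (\<beta> - \<gamma>)) =
      (1 / (1 - \<beta>) + 1 / (\<beta> - \<gamma>)) * r powr (- \<beta>)"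
  proof -
    have "r powr (- \<beta> + 1) = r powr (- \<beta>) * r"
      using r by (simp only: powr_add powr_one less_imp_le)
    then have "1 / r * (r powr (- \<beta> + 1) / (- \<beta> + 1)) = 1 / (1 - \<beta>) * r powr (- \<beta>)"
      using r by simp
    moreover have "r powr (- \<gamma>) * r powr (\<gamma> - \<beta>) = r powr (- \<beta>)"
      by (simp flip: powr_add)
    ultimately show ?thesis
      by (simp add: distrib_right)
  qed
  finally show ?thesis .
qed

subsection \<open>Taylor remainders against the jump of the potential\<close>

lemma integral_translate:
  fixes h :: "'a::euclidean_space \<Rightarrow> 'b::{banach, second_countable_topology}"
  assumes "h \<in> borel_measurable borel"
  shows "integral\<^sup>L lborel h = (\<integral>u. h (p + u) \<partial>lborel)"
  using lborel_affine_integral[OF assms, of 1 p] by simp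

lemma integrable_translate:
  fixes h :: "'a::euclidean_space \<Rightarrow> 'b::{banach, second_countable_topology}"
  assumes "integrable lborel h"
  shows "integrable lborel (\<lambda>u. h (p + u))"
  using lborel_affine_integrable_iff[of h 1 p] assms by simp

lemma integrable_mult_square_integrable:
  fixes f g :: "'a \<Rightarrow> real"
  assumes [measurable]: "f \<in> borel_measurable M" "g \<in> borel_measurable M"
    and "integrable M (\<lambda>x. (f x)\<^sup>2)" "integrable M (\<lambda>x. (g x)\<^sup>2)"
  shows "integrable M (\<lambda>x. f x * g x)"
proof (rule Bochner_Integration.integrable_bound)
  show "integrable M (\<lambda>x. (f x)\<^sup>2 + (g x)\<^sup>2)"
    using assms by auto
  have "\<bar>a * b\<bar> \<le> a\<^sup>2 + b\<^sup>2" for a b :: real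
    using zero_le_power2[of "\<bar>a\<bar> - \<bar>b\<bar>"] zero_le_power2[of a] zero_le_power2[of b]
    unfolding power2_diff abs_mult power2_abs by linarith
  then show "AE x in M. norm (f x * g x) \<le> norm ((f x)\<^sup>2 + (g x)\<^sup>2)"
    by simp
qed measurable

lemma integral_heat_dipole_eq_0:
  fixes e :: "'a::euclidean_space"
  shows "integral\<^sup>L lborel (heat_dipole e r) = 0"
proof -
  have odd: "heat_dipole e r (- u) = - heat_dipole e r u" for u
    by (simp add: heat_dipole_def)
  have "integral\<^sup>L lborel (heat_dipole e r) = (\<integral>u. heat_dipole e r (- u) \<partial>lborel)"
    using lborel_affine_integral[of "heat_dipole e r" "- 1" 0] by simp
  also have "\<dots> = - integral\<^sup>L lborel (heat_dipole e r)"
    by (simp add: odd)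
  finally show ?thesis
    by simp
qed

lemma integrable_inner_heat_dipole:
  fixes e l :: "'a::euclidean_space"
  assumes e: "e \<in> Basis" and r: "0 < r"
  shows "integrable lborel (\<lambda>u. (l \<bullet> u) * heat_dipole e r u)"
proof (rule Bochner_Integration.integrable_bound)
  show "integrable lborel (\<lambda>u. norm l * (norm u powr 1 * \<bar>heat_dipole e r u\<bar>))"
    using integrable_heat_dipole_moment[OF e r, of 1] by simp
  have "\<bar>(l \<bullet> u) * heat_dipole e r u\<bar> \<le> norm l * norm u * \<bar>heat_dipole e r u\<bar>" for u
    unfolding abs_mult by (intro mult_right_mono Cauchy_Schwarz_ineq2) auto
  then show "AE u in lborel. norm ((l \<bullet> u) * heat_dipole e r u) \<le>
      norm (norm l * (norm u powr 1 * \<bar>heat_dipole e r u\<bar>))"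
    by (simp add: abs_mult mult.assoc)
qed measurable

text \<open>A factor of degree one contributes \<open>sqrt r\<close>, which exactly cancels
  \<open>r powr (- 1 / 2)\<close>; so linear functions drop out of differences of scales although
  they do not pair to 0.\<close>

lemma integral_inner_heat_dipole:
  fixes e l :: "'a::euclidean_space"
  assumes r: "0 < r"
  shows "(\<integral>u. (l \<bullet> u) * heat_dipole e r u \<partial>lborel) = (\<integral>u. (l \<bullet> u) * heat_dipole e 1 u \<partial>lborel)"
proof -
  have "(\<integral>u. (l \<bullet> u) * heat_dipole e (1 * r) u \<partial>lborel) =
      r powr (- 1 / 2) * (\<integral>u. sqrt r * ((l \<bullet> u) * heat_dipole e 1 u) \<partial>lborel)"
    using r by (subst integral_heat_dipole_scale) (simp_all add: mult.assoc)
  also have "\<dots> = (r powr (- 1 / 2) * sqrt r) * (\<integral>u. (l \<bullet> u) * heat_dipole e 1 u \<partial>lborel)"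
    by simp
  also have "r powr (- 1 / 2) * sqrt r = 1"
    using r by (simp add: powr_half_sqrt[symmetric] flip: powr_add)
  finally show ?thesis
    by simp
qed

text \<open>
  Only the Taylor remainder of \<open>f\<close> matters, since the dipoles at any two scales have the same
  moments of order at most one.
\<close>

lemma multiplier_pairing_growth:
  fixes e p l :: "'a::euclidean_space" and f \<psi> :: "'a \<Rightarrow> real"
  assumes fg: "(\<lambda>x. complex_of_real (f x), g) \<in> fourier_multiplier (\<lambda>y. Phi m \<alpha> ((norm y)\<^sup>2))"
    and \<alpha>: "0 < \<alpha>" "\<alpha> < 2" and m: "0 \<le> m" and e: "e \<in> Basis"
    and f [measurable]: "f \<in> borel_measurable borel" and f2: "integrable lborel (\<lambda>x. (f x)\<^sup>2)"
    and taylor: "\<And>u. \<bar>f (p + u) - f p - l \<bullet> u\<bar> \<le> C * norm u powr s + indicator {u. 1 \<le> norm u} u * \<psi> u"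
    and C: "0 \<le> C" and \<psi>: "integrable lborel \<psi>" "\<And>u. 0 \<le> \<psi> u" and s: "0 \<le> s" "s < 1 + \<alpha>"
  obtains A where "\<And>r. 0 < r \<Longrightarrow> norm (\<integral>x. g x * of_real (heat_dipole e r (x - p)) \<partial>lborel)
    \<le> A * (r powr ((s - 1 - \<alpha>) / 2) + 1)"
proof -
  define \<beta> where "\<beta> = \<alpha> / 2"
  \<comment> \<open>The growth exponent of the moment of order s in the scale, cut off at 0 for
    \<open>s < 1\<close>. The condition \<open>\<gamma> < \<beta>\<close> is where
    \<open>s < 1 + \<alpha>\<close> is used.\<close>
  define \<gamma> where "\<gamma> = max 0 ((s - 1) / 2)"
  have \<beta>: "0 < \<beta>" "\<beta> < 1" and \<gamma>: "0 \<le> \<gamma>" "\<gamma> < \<beta>" "(s - 1) / 2 \<le> \<gamma>"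
    using \<alpha> s by (auto simp: \<beta>_def \<gamma>_def max_def)
  obtain K where K: "0 \<le> K" "\<And>t. 0 < t \<Longrightarrow>
      (\<integral>w. norm w powr s * \<bar>heat_dipole e 1 w - heat_dipole e (1 + 2 * t) w\<bar> \<partial>lborel) \<le> K * min t (t powr \<gamma>)"
    using heat_dipole_unit_diff_moment[OF e s(1) \<gamma>(1) _ \<gamma>(3)] \<gamma> \<beta> by auto
  obtain K' where K': "0 \<le> K'" "\<And>r t u. 0 < r \<Longrightarrow> 0 \<le> t \<Longrightarrow> 1 \<le> norm u \<Longrightarrow>
      \<bar>heat_dipole e r u - heat_dipole e (r + 2 * t) u\<bar> \<le> K' * min t 1"
    using heat_dipole_outside_bound[OF e] by metis
  define \<Psi> where "\<Psi> = integral\<^sup>L lborel \<psi>"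
  have \<Psi>: "0 \<le> \<Psi>"
    unfolding \<Psi>_def using \<psi>(2) by (intro integral_nonneg_AE) auto
  define q where "q r = (\<integral>u. f (p + u) * heat_dipole e r u \<partial>lborel)" for r
  define R where "R u = f (p + u) - f p - l \<bullet> u" for u
  have [measurable]: "R \<in> borel_measurable borel"
    unfolding R_def[abs_def] by measurable
  have fi: "integrable lborel (\<lambda>u. f (p + u) * heat_dipole e r u)" if "0 < r" for r
    using integrable_translate[OF f2, of p] heat_dipole_L2[OF e that]
    by (intro integrable_mult_square_integrable) auto
  have ci: "integrable lborel (\<lambda>u. f p * heat_dipole e r u)" if "0 < r" for r
    using integrable_heat_dipole[OF e that] by simp
  have R: "integrable lborel (\<lambda>u. R u * heat_dipole e r u)"
    "(\<integral>u. R u * heat_dipole e r u \<partial>lborel) = q r - (\<integral>u. (l \<bullet> u) * heat_dipole e 1 u \<partial>lborel)" if "0 < r" for r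
  proof -
    have *: "(\<lambda>u. R u * heat_dipole e r u) =
        (\<lambda>u. f (p + u) * heat_dipole e r u - f p * heat_dipole e r u - (l \<bullet> u) * heat_dipole e r u)"
      by (simp add: R_def left_diff_distrib)
    show "integrable lborel (\<lambda>u. R u * heat_dipole e r u)"
      unfolding * using fi ci integrable_inner_heat_dipole[OF e] that by simp
    show "(\<integral>u. R u * heat_dipole e r u \<partial>lborel) = q r - (\<integral>u. (l \<bullet> u) * heat_dipole e 1 u \<partial>lborel)"
      unfolding * using fi[OF that] ci[OF that] integrable_inner_heat_dipole[OF e that, of l]
      by (simp add: q_def integral_inner_heat_dipole[OF that] integral_heat_dipole_eq_0)
  qed
  have Q: "(\<integral>x. complex_of_real (f x) * of_real (heat_dipole e r (x - p)) \<partial>lborel) = of_real (q r)" for r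
  proof -
    have "(\<integral>x. complex_of_real (f x) * of_real (heat_dipole e r (x - p)) \<partial>lborel) =
        (\<integral>x. complex_of_real (f x * heat_dipole e r (x - p)) \<partial>lborel)"
      by simp
    also have "\<dots> = of_real (\<integral>x. f x * heat_dipole e r (x - p) \<partial>lborel)"
      by (rule integral_complex_of_real)
    also have "(\<integral>x. f x * heat_dipole e r (x - p) \<partial>lborel) = q r"
      unfolding q_def by (subst integral_translate[where p = p]) auto
    finally show ?thesis .
  qed
  \<comment> \<open>The first term is the Taylor remainder at its own scale r, the second the tail
    outside the unit ball. Writing \<open>min t 1\<close> with \<open>t / 1\<close> and exponent 0
    gives the tail the same shape, so one integral estimate serves both.\<close>
  have q_diff: "\<bar>q r - q (r + 2 * t)\<bar> \<le>
      C * K * r powr ((s - 1) / 2) * min (t / r) ((t / r) powr \<gamma>) + K' * \<Psi> * min (t / 1) ((t / 1) powr 0)"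
    if r: "0 < r" and t: "0 < t" for r t
  proof -
    let ?D = "\<lambda>u. heat_dipole e r u - heat_dipole e (r + 2 * t) u"
    have rt: "0 < r + 2 * t" using r t by simp
    have Di: "integrable lborel (\<lambda>u. norm u powr s * \<bar>?D u\<bar>)"
    proof (rule Bochner_Integration.integrable_bound)
      show "integrable lborel (\<lambda>u. norm u powr s * \<bar>heat_dipole e r u\<bar> + norm u powr s * \<bar>heat_dipole e (r + 2 * t) u\<bar>)"
        using integrable_heat_dipole_moment[OF e r s(1)] integrable_heat_dipole_moment[OF e rt s(1)]
        by simp
      show "AE u in lborel. norm (norm u powr s * \<bar>?D u\<bar>) \<le>
          norm (norm u powr s * \<bar>heat_dipole e r u\<bar> + norm u powr s * \<bar>heat_dipole e (r + 2 * t) u\<bar>)"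
        by (intro AE_I2) (auto simp flip: distrib_left intro!: mult_left_mono abs_triangle_ineq4)
    qed measurable
    have "q r - q (r + 2 * t) = (\<integral>u. R u * ?D u \<partial>lborel)"
      using R[OF r] R[OF rt] by (simp add: right_diff_distrib)
    also have "\<bar>\<dots>\<bar> \<le> (\<integral>u. C * (norm u powr s * \<bar>?D u\<bar>) + (K' * min t 1) * \<psi> u \<partial>lborel)"
    proof (rule integral_abs_bound[THEN order_trans], rule integral_mono')
      show "integrable lborel (\<lambda>u. C * (norm u powr s * \<bar>?D u\<bar>) + (K' * min t 1) * \<psi> u)"
        using Di \<psi>(1) by simp
      fix u :: 'a
      have "\<bar>R u * ?D u\<bar> \<le> (C * norm u powr s + indicator {u. 1 \<le> norm u} u * \<psi> u) * \<bar>?D u\<bar>"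
        unfolding abs_mult R_def by (intro mult_right_mono taylor) simp
      also have "\<dots> = C * (norm u powr s * \<bar>?D u\<bar>) + indicator {u. 1 \<le> norm u} u * \<psi> u * \<bar>?D u\<bar>"
        by (simp add: algebra_simps)
      also have "indicator {u. 1 \<le> norm u} u * \<psi> u * \<bar>?D u\<bar> \<le> (K' * min t 1) * \<psi> u"
      proof (cases "1 \<le> norm u")
        case True
        then show ?thesis
          using mult_right_mono[OF K'(2)[OF r _ True, of t] \<psi>(2)[of u]] t by (simp add: mult.commute)
      qed (use K'(1) \<psi>(2) t in simp)
      finally show "\<bar>R u * ?D u\<bar> \<le> C * (norm u powr s * \<bar>?D u\<bar>) + (K' * min t 1) * \<psi> u"
        by simp
    next
      fix u :: 'a
      show "0 \<le> C * (norm u powr s * \<bar>?D u\<bar>) + (K' * min t 1) * \<psi> u"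
        using C K'(1) \<psi>(2) t by simp
    qed
    also have "\<dots> = C * (\<integral>u. norm u powr s * \<bar>?D u\<bar> \<partial>lborel) + K' * min t 1 * \<Psi>"
      using Di \<psi>(1) by (simp add: \<Psi>_def)
    also have "\<dots> \<le> C * (r powr ((s - 1) / 2) * (K * min (t / r) ((t / r) powr \<gamma>))) + K' * min t 1 * \<Psi>"
    proof (intro add_right_mono mult_left_mono C)
      \<comment> \<open>Dilation by \<open>sqrt r\<close> reduces the scales r and
        \<open>r + 2 * t\<close> to 1 and \<open>1 + 2 * (t / r)\<close>.\<close>
      have "(1 + 2 * (t / r)) * r = r + 2 * t" "0 < 1 + 2 * (t / r)"
        using r t by (auto simp: field_simps intro!: add_pos_pos)
      then have "(\<integral>u. norm u powr s * \<bar>?D u\<bar> \<partial>lborel) = r powr ((s - 1) / 2) *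
          (\<integral>w. norm w powr s * \<bar>heat_dipole e 1 w - heat_dipole e (1 + 2 * (t / r)) w\<bar> \<partial>lborel)"
        using heat_dipole_moment_scale[OF r, of 1 "1 + 2 * (t / r)" s 1 e 1] by simp
      also have "\<dots> \<le> r powr ((s - 1) / 2) * (K * min (t / r) ((t / r) powr \<gamma>))"
        using r t by (intro mult_left_mono K(2)) auto
      finally show "(\<integral>u. norm u powr s * \<bar>?D u\<bar> \<partial>lborel) \<le>
          r powr ((s - 1) / 2) * (K * min (t / r) ((t / r) powr \<gamma>))" .
    qed
    finally show ?thesis
      using t by (simp add: mult_ac)
  qed
  define J where "J \<gamma> = 1 / (1 - \<beta>) + 1 / (\<beta> - \<gamma>)" for \<gamma>
  define \<kappa> where "\<kappa> = Gamma (1 - \<alpha> / 2) / (\<alpha> / 2)"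
  have \<kappa>: "0 < \<kappa>"
    using \<alpha> by (simp add: \<kappa>_def Gamma_real_pos)
  have J: "0 \<le> J \<gamma>" "0 \<le> J 0"
    using \<beta> \<gamma> by (auto simp: J_def)
  define B where "B = C * K * J \<gamma> + K' * \<Psi> * J 0"
  have bound: "\<kappa> * norm (\<integral>x. g x * of_real (heat_dipole e r (x - p)) \<partial>lborel)
      \<le> C * K * J \<gamma> * r powr ((s - 1 - \<alpha>) / 2) + K' * \<Psi> * J 0" if r: "0 < r" for r
  proof -
    let ?a = "C * K * r powr ((s - 1) / 2)" and ?b = "K' * \<Psi>"
    let ?k = "\<lambda>\<rho> \<gamma> t. ennreal (indicator {0<..} t * (t powr (- 1 - \<beta>) * min (t / \<rho>) ((t / \<rho>) powr \<gamma>)))"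
    have ab: "0 \<le> ?a" "0 \<le> ?b"
      using C K K' \<Psi> by auto
    have "ennreal (\<kappa> * norm (\<integral>x. g x * of_real (heat_dipole e r (x - p)) \<partial>lborel)) \<le>
        (\<integral>\<^sup>+t. ennreal (indicator {0<..} t * (t powr (- 1 - \<alpha> / 2) * norm (complex_of_real (q r) - of_real (q (r + 2 * t))))) \<partial>lborel)"
      using multiplier_pairing_le[OF fg \<alpha> m e r, of p] unfolding Q \<kappa>_def .
    also have "\<dots> \<le> (\<integral>\<^sup>+t. ennreal ?a * ?k r \<gamma> t + ennreal ?b * ?k 1 0 t \<partial>lborel)"
    proof (rule nn_integral_mono)
      fix t :: real
      show "ennreal (indicator {0<..} t * (t powr (- 1 - \<alpha> / 2) * norm (complex_of_real (q r) - of_real (q (r + 2 * t)))))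
          \<le> ennreal ?a * ?k r \<gamma> t + ennreal ?b * ?k 1 0 t"
      proof (cases "0 < t")
        case True
        have xy: "0 \<le> t powr (- 1 - \<beta>) * min (t / r) ((t / r) powr \<gamma>)"
            "0 \<le> t powr (- 1 - \<beta>) * min (t / 1) ((t / 1) powr 0)"
          using True r by simp_all
        have "t powr (- 1 - \<beta>) * \<bar>q r - q (r + 2 * t)\<bar> \<le>
          t powr (- 1 - \<beta>) * (?a * min (t / r) ((t / r) powr \<gamma>) + ?b * min (t / 1) ((t / 1) powr 0))"
          by (intro mult_left_mono q_diff r True) simp
        also have "\<dots> = ?a * (t powr (- 1 - \<beta>) * min (t / r) ((t / r) powr \<gamma>)) +
            ?b * (t powr (- 1 - \<beta>) * min (t / 1) ((t / 1) powr 0))"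
          by (simp only: distrib_left mult.left_commute)
        finally have "ennreal (t powr (- 1 - \<beta>) * \<bar>q r - q (r + 2 * t)\<bar>) \<le>
            ennreal (?a * (t powr (- 1 - \<beta>) * min (t / r) ((t / r) powr \<gamma>)) +
              ?b * (t powr (- 1 - \<beta>) * min (t / 1) ((t / 1) powr 0)))"
          by (rule ennreal_leI)
        also have "\<dots> = ennreal ?a * ennreal (t powr (- 1 - \<beta>) * min (t / r) ((t / r) powr \<gamma>)) +
            ennreal ?b * ennreal (t powr (- 1 - \<beta>) * min (t / 1) ((t / 1) powr 0))"
          using ab xy by (simp only: ennreal_plus ennreal_mult mult_nonneg_nonneg)
        finally show ?thesis
          using True by (simp add: \<beta>_def flip: of_real_diff)
      qed simp
    qed
    also have "\<dots> = ennreal ?a * (\<integral>\<^sup>+t. ?k r \<gamma> t \<partial>lborel) + ennreal ?b * (\<integral>\<^sup>+t. ?k 1 0 t \<partial>lborel)"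
      by (subst nn_integral_add) (auto simp: nn_integral_cmult)
    also have "\<dots> \<le> ennreal ?a * ennreal (J \<gamma> * r powr (- \<beta>)) + ennreal ?b * ennreal (J 0 * 1 powr (- \<beta>))"
      unfolding J_def using r \<gamma> \<beta> by (intro add_mono mult_left_mono nn_integral_powr_min_le) auto
    also have "\<dots> = ennreal (?a * (J \<gamma> * r powr (- \<beta>)) + ?b * J 0)"
      using ab J by (simp add: ennreal_mult ennreal_plus)
    finally have "\<kappa> * norm (\<integral>x. g x * of_real (heat_dipole e r (x - p)) \<partial>lborel) \<le> ?a * (J \<gamma> * r powr (- \<beta>)) + ?b * J 0"
      using ab J by (subst (asm) ennreal_le_iff) auto
    moreover have "r powr ((s - 1) / 2) * r powr (- \<beta>) = r powr ((s - 1 - \<alpha>) / 2)"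
      by (simp add: \<beta>_def diff_divide_distrib flip: powr_add)
    ultimately show ?thesis
      by (simp add: mult_ac)
  qed
  show ?thesis
  proof (rule that)
    fix r :: real assume r: "0 < r"
    let ?N = "norm (\<integral>x. g x * of_real (heat_dipole e r (x - p)) \<partial>lborel)"
    have "\<kappa> * ?N \<le> C * K * J \<gamma> * r powr ((s - 1 - \<alpha>) / 2) + K' * \<Psi> * J 0"
      by (rule bound[OF r])
    also have "\<dots> \<le> B * (r powr ((s - 1 - \<alpha>) / 2) + 1)"
    proof -
      have "0 \<le> C * K * J \<gamma>" "0 \<le> K' * \<Psi> * J 0 * r powr ((s - 1 - \<alpha>) / 2)"
        using C K K' \<Psi> J by auto
      then show ?thesis
        by (simp add: B_def algebra_simps)
    qed
    finally show "?N \<le> (B / \<kappa>) * (r powr ((s - 1 - \<alpha>) / 2) + 1)"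
      using \<kappa> by (simp add: field_simps)
  qed
qed

section \<open>The jump term and the comparison of orders\<close>

lemma pred_ball [measurable]:
  fixes f :: "'a \<Rightarrow> 'b::euclidean_space"
  assumes [measurable]: "f \<in> borel_measurable M"
  shows "Measurable.pred M (\<lambda>x. f x \<in> ball c a)"
  unfolding mem_ball by measurable

text \<open>
  The dipole is positive on the ball when it sits at a boundary point with its axis pointing inwards, and
  dilating the ball about this point by \<open>1 / sqrt r\<close> only enlarges it.
\<close>

lemma heat_dipole_half_ball_lower:
  fixes e :: "'a::euclidean_space"
  assumes e: "e \<in> Basis" and a: "0 < a"
  obtains c where "0 < c" "\<And>r. 0 < r \<Longrightarrow> r \<le> 1 \<Longrightarrow>
    c * r powr (- 1 / 2) \<le> (\<integral>u. indicator (ball 0 a) (- (a *\<^sub>R e) + u) * heat_dipole e r u \<partial>lborel)"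
proof -
  let ?p = "- (a *\<^sub>R e)"
  let ?h = "\<lambda>w. indicator (ball 0 a) (?p + w) * heat_dipole e 1 w"
  \<comment> \<open>Both uses of the geometry are visible in this form: it forces
    \<open>0 < w \<bullet> e\<close>, and replacing w by \<open>sqrt r *\<^sub>R w\<close>
    multiplies the left side by r but the right side by \<open>sqrt r\<close>, which is no smaller
    for \<open>r \<le> 1\<close>.\<close>
  have ball_iff: "?p + w \<in> ball 0 a \<longleftrightarrow> (norm w)\<^sup>2 < 2 * a * (w \<bullet> e)" for w
  proof -
    have "?p + w \<in> ball 0 a \<longleftrightarrow> norm (w - a *\<^sub>R e) < a"
      by simp
    also have "\<dots> \<longleftrightarrow> (norm (w - a *\<^sub>R e))\<^sup>2 < a\<^sup>2"
      using a power_strict_mono[of "norm (w - a *\<^sub>R e)" a 2] power2_less_imp_less[of "norm (w - a *\<^sub>R e)" a]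
      by auto
    also have "(norm (w - a *\<^sub>R e))\<^sup>2 = (norm w)\<^sup>2 - 2 * a * (w \<bullet> e) + a\<^sup>2"
      using inner_same_Basis[OF e] unfolding power2_norm_eq_inner power2_eq_square[of a]
      by (simp add: inner_diff_left inner_diff_right inner_commute algebra_simps)
    finally show ?thesis
      by simp
  qed
  have pos: "0 < w \<bullet> e" if "?p + w \<in> ball 0 a" for w
    using le_less_trans[OF zero_le_power2 that[unfolded ball_iff]] a by (simp add: zero_less_mult_iff)
  have h_nonneg: "0 \<le> ?h w" for w
    using pos[of w] by (auto simp: indicator_def heat_dipole_def)
  have int: "integrable lborel (\<lambda>u. indicator (ball 0 a) (q + b *\<^sub>R u) * heat_dipole e 1 u)" for q b
    by (rule Bochner_Integration.integrable_bound[OF integrable_heat_dipole[OF e zero_less_one]])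
      (auto simp: indicator_def)
  have int1: "integrable lborel ?h"
    using int[of ?p 1] by simp
  define c where "c = integral\<^sup>L lborel ?h"
  \<comment> \<open>A nonnegative integrand with integral 0 vanishes almost everywhere, but it is
    positive on the shifted ball, which has positive measure.\<close>
  have "c \<noteq> 0"
  proof
    assume "c = 0"
    then have "AE w in lborel. ?h w = 0"
      using integral_nonneg_eq_0_iff_AE[OF int1] h_nonneg by (simp add: c_def)
    then have "AE w in lborel. w \<notin> ball (a *\<^sub>R e) a"
    proof eventually_elim
      case (elim w)
      show ?case
      proof
        assume "w \<in> ball (a *\<^sub>R e) a"
        then have "?p + w \<in> ball 0 a"
          by (simp add: dist_norm)
        with pos[OF this] elim show False
          by (simp add: heat_dipole_def)
      qed
    qed
    then have "emeasure lborel (ball (a *\<^sub>R e) a) = 0"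
      by (subst (asm) AE_iff_measurable[OF _ refl]) (simp_all del: mem_ball)
    then have "measure lborel (ball (a *\<^sub>R e) a) = 0"
      by (simp add: measure_def)
    with content_ball_pos[OF a, of "a *\<^sub>R e"] show False
      by simp
  qed
  then have c: "0 < c"
    using integral_nonneg_AE[of ?h lborel] h_nonneg by (simp add: c_def less_le)
  show ?thesis
  proof (rule that[OF c])
    fix r :: real assume r: "0 < r" "r \<le> 1"
    let ?I = "\<integral>w. indicator (ball 0 a) (?p + sqrt r *\<^sub>R w) * heat_dipole e 1 w \<partial>lborel"
    have eq: "(\<integral>u. indicator (ball 0 a) (?p + u) * heat_dipole e (1 * r) u \<partial>lborel) =
        r powr (- 1 / 2) * ?I"
      using r by (intro integral_heat_dipole_scale) auto
    have le: "c \<le> ?I"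
      unfolding c_def
    proof (rule integral_mono[OF int1 int])
      fix w :: 'a
      have sr: "0 < sqrt r" "sqrt r \<le> 1" "sqrt r * sqrt r = r"
        using r by auto
      have in_ball: "?p + sqrt r *\<^sub>R w \<in> ball 0 a" if w: "?p + w \<in> ball 0 a"
      proof -
        have "(norm (sqrt r *\<^sub>R w))\<^sup>2 = sqrt r * (sqrt r * (norm w)\<^sup>2)"
          using r by (simp add: power_mult_distrib)
        also have "\<dots> \<le> sqrt r * (1 * (norm w)\<^sup>2)"
          using sr by (intro mult_left_mono mult_right_mono) auto
        also have "\<dots> < sqrt r * (2 * a * (w \<bullet> e))"
          using sr w unfolding ball_iff by (intro mult_strict_left_mono) auto
        finally show ?thesis
          unfolding ball_iff by (simp add: mult_ac)
      qed
      have nonneg: "0 \<le> heat_dipole e 1 w" if "?p + sqrt r *\<^sub>R w \<in> ball 0 a"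
        using pos[OF that] sr by (simp add: heat_dipole_def zero_less_mult_iff)
      show "?h w \<le> indicator (ball 0 a) (?p + sqrt r *\<^sub>R w) * heat_dipole e 1 w"
        using in_ball nonneg by (auto simp only: indicator_def split: if_split) auto
    qed
    have "r powr (- 1 / 2) * c \<le> r powr (- 1 / 2) * ?I"
      by (intro mult_left_mono le) simp
    then show "c * r powr (- 1 / 2) \<le> (\<integral>u. indicator (ball 0 a) (?p + u) * heat_dipole e r u \<partial>lborel)"
      unfolding eq[symmetric] by (simp only: mult_1 mult.commute)
  qed
qed

text \<open>Treats the error of freezing f at p in the potential term. The linear part has a
  scale-invariant moment, the part of order s gives \<open>r powr ((s - 1) / 2)\<close>, and the
  tail meets a bounded dipole. For \<open>0 < s\<close> the sum is of smaller order than
  \<open>r powr (- 1 / 2)\<close>.\<close>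

lemma heat_dipole_weighted_integral_bound:
  fixes e l :: "'a::euclidean_space" and S :: "'a \<Rightarrow> real"
  assumes e: "e \<in> Basis" and [measurable]: "S \<in> borel_measurable borel"
    and le: "\<And>u. \<bar>S u\<bar> \<le> L * norm u + C * norm u powr s + indicator {u. 1 \<le> norm u} u * \<psi> u"
    and \<psi>: "integrable lborel \<psi>" "\<And>u. 0 \<le> \<psi> u" and s: "0 \<le> s" and LC: "0 \<le> L" "0 \<le> C"
  obtains A where "\<And>r. 0 < r \<Longrightarrow> integrable lborel (\<lambda>u. S u * heat_dipole e r u)"
    "\<And>r. 0 < r \<Longrightarrow> \<bar>\<integral>u. S u * heat_dipole e r u \<partial>lborel\<bar> \<le> A * (r powr ((s - 1) / 2) + 1)"
proof -
  obtain K where K: "0 \<le> K" "\<And>r u. 0 < r \<Longrightarrow> 1 \<le> norm u \<Longrightarrow> \<bar>heat_dipole e r u\<bar> \<le> K"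
    using heat_dipole_outside_bound[OF e] by metis
  define M where "M q = (\<integral>u. norm u powr q * \<bar>heat_dipole e 1 u\<bar> \<partial>lborel)" for q
  define \<Psi> where "\<Psi> = integral\<^sup>L lborel \<psi>"
  have nonneg: "0 \<le> M q" "0 \<le> \<Psi>" for q
    using \<psi>(2) by (auto simp: M_def \<Psi>_def intro!: integral_nonneg_AE)
  let ?B = "\<lambda>r u. L * (norm u powr 1 * \<bar>heat_dipole e r u\<bar>) + C * (norm u powr s * \<bar>heat_dipole e r u\<bar>) + K * \<psi> u"
  have B: "integrable lborel (?B r)" if "0 < r" for r
    using integrable_heat_dipole_moment[OF e that, of 1] integrable_heat_dipole_moment[OF e that s] \<psi>(1) by simp
  have Bv: "integral\<^sup>L lborel (?B r) = L * M 1 + C * (r powr ((s - 1) / 2) * M s) + K * \<Psi>" if "0 < r" for r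
    using integrable_heat_dipole_moment[OF e that, of 1] integrable_heat_dipole_moment[OF e that s] \<psi>(1)
      heat_dipole_moment_scale[OF that, of 1 1 1 1 e 0] heat_dipole_moment_scale[OF that, of 1 1 s 1 e 0] that
    by (simp add: M_def \<Psi>_def)
  have SB: "\<bar>S u * heat_dipole e r u\<bar> \<le> ?B r u" if r: "0 < r" for r u
  proof -
    have "\<bar>S u * heat_dipole e r u\<bar> \<le>
        (L * norm u + C * norm u powr s + indicator {u. 1 \<le> norm u} u * \<psi> u) * \<bar>heat_dipole e r u\<bar>"
      unfolding abs_mult by (intro mult_right_mono le) simp
    also have "\<dots> = L * (norm u powr 1 * \<bar>heat_dipole e r u\<bar>) + C * (norm u powr s * \<bar>heat_dipole e r u\<bar>) +
        indicator {u. 1 \<le> norm u} u * \<psi> u * \<bar>heat_dipole e r u\<bar>"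
      by (simp add: algebra_simps)
    also have "indicator {u. 1 \<le> norm u} u * \<psi> u * \<bar>heat_dipole e r u\<bar> \<le> K * \<psi> u"
    proof (cases "1 \<le> norm u")
      case True
      then show ?thesis
        using mult_right_mono[OF K(2)[OF r True] \<psi>(2)[of u]] by (simp add: mult.commute)
    qed (use K(1) \<psi>(2) in simp)
    finally show ?thesis
      by simp
  qed
  have i: "integrable lborel (\<lambda>u. S u * heat_dipole e r u)" if "0 < r" for r
    by (rule Bochner_Integration.integrable_bound[OF B[OF that]], measurable)
      (intro AE_I2, simp only: real_norm_def order_trans[OF SB[OF that] abs_ge_self])
  show ?thesis
  proof (rule that[OF i])
    fix r :: real assume r: "0 < r"
    have "\<bar>\<integral>u. S u * heat_dipole e r u \<partial>lborel\<bar> \<le> integral\<^sup>L lborel (?B r)"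
      using SB[OF r] by (intro integral_abs_bound[THEN order_trans] integral_mono B integrable_abs i r)
    also have "\<dots> \<le> (L * M 1 + C * M s + K * \<Psi>) * (r powr ((s - 1) / 2) + 1)"
    proof -
      have "0 \<le> L * M 1 * r powr ((s - 1) / 2)" "0 \<le> C * M s" "0 \<le> K * \<Psi> * r powr ((s - 1) / 2)"
        using LC nonneg K by auto
      then show ?thesis
        unfolding Bv[OF r] by (simp add: algebra_simps)
    qed
    finally show "\<bar>\<integral>u. S u * heat_dipole e r u \<partial>lborel\<bar> \<le> (L * M 1 + C * M s + K * \<Psi>) * (r powr ((s - 1) / 2) + 1)" .
  qed
qed

text \<open>Both regularity classes enter through this one statement: all that is used of them is a
  single expansion at a single boundary point, with \<open>l = 0\<close> in the Hoelder case and l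
  the gradient in the differentiable case. Far from p a square-integrable f only offers an
  integrable majorant \<open>\<psi>\<close>.\<close>

lemma potential_well_no_taylor_expansion:
  fixes e l :: "'a::euclidean_space" and f \<psi> :: "'a \<Rightarrow> real"
  assumes fg: "(\<lambda>x. complex_of_real (f x), g) \<in> fourier_multiplier (\<lambda>y. Phi m \<alpha> ((norm y)\<^sup>2))"
    and eq: "AE x in lborel. g x = of_real ((E + v * indicator (ball 0 a) x) * f x)"
    and \<alpha>: "0 < \<alpha>" "\<alpha> < 2" and m: "0 \<le> m" and e: "e \<in> Basis" and a: "0 < a" and v: "0 < v"
    and f: "f \<in> borel_measurable borel" "integrable lborel (\<lambda>x. (f x)\<^sup>2)"
    and p: "p = - (a *\<^sub>R e)" "0 < f p"
    and taylor: "\<And>u. \<bar>f (p + u) - f p - l \<bullet> u\<bar> \<le> C * norm u powr s + indicator {u. 1 \<le> norm u} u * \<psi> u"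
    and C: "0 \<le> C" and \<psi>: "integrable lborel \<psi>" "\<And>u. 0 \<le> \<psi> u" and s: "\<alpha> < s" "s < 1 + \<alpha>"
  shows False
proof -
  have s0: "0 \<le> s" using s \<alpha> by simp
  note f(1) [measurable]
  have gm [measurable]: "g \<in> borel_measurable borel"
    using fg by (auto simp: fourier_multiplier_def plancherel_def dest: L2_space_measurable)
  obtain A where A: "\<And>r. 0 < r \<Longrightarrow> norm (\<integral>x. g x * of_real (heat_dipole e r (x - p)) \<partial>lborel)
      \<le> A * (r powr ((s - 1 - \<alpha>) / 2) + 1)"
    using multiplier_pairing_growth[OF fg \<alpha> m e f taylor C \<psi> s0 s(2)] by blast
  obtain c where c: "0 < c" "\<And>r. 0 < r \<Longrightarrow> r \<le> 1 \<Longrightarrow>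
      c * r powr (- 1 / 2) \<le> (\<integral>u. indicator (ball 0 a) (p + u) * heat_dipole e r u \<partial>lborel)"
    using heat_dipole_half_ball_lower[OF e a] unfolding p(1) by blast
  define S where "S u = (E + v * indicator (ball 0 a) (p + u)) * (f (p + u) - f p)" for u
  have [measurable]: "S \<in> borel_measurable borel"
    unfolding S_def[abs_def] by measurable
  have S_le: "\<bar>S u\<bar> \<le> (\<bar>E\<bar> + v) * norm l * norm u + (\<bar>E\<bar> + v) * C * norm u powr s +
      indicator {u. 1 \<le> norm u} u * ((\<bar>E\<bar> + v) * \<psi> u)" for u
  proof -
    have "\<bar>f (p + u) - f p\<bar> \<le> \<bar>l \<bullet> u\<bar> + \<bar>f (p + u) - f p - l \<bullet> u\<bar>"
      by linarith
    also have "\<dots> \<le> norm l * norm u + (C * norm u powr s + indicator {u. 1 \<le> norm u} u * \<psi> u)"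
      by (intro add_mono Cauchy_Schwarz_ineq2 taylor)
    finally have 1: "\<bar>f (p + u) - f p\<bar> \<le> norm l * norm u + (C * norm u powr s + indicator {u. 1 \<le> norm u} u * \<psi> u)" .
    have "\<bar>E + v * indicator (ball 0 a) (p + u)\<bar> \<le> \<bar>E\<bar> + v"
      using v by (auto simp: indicator_def)
    then have "\<bar>S u\<bar> \<le> (\<bar>E\<bar> + v) * (norm l * norm u + (C * norm u powr s + indicator {u. 1 \<le> norm u} u * \<psi> u))"
      unfolding S_def abs_mult using 1 v by (intro mult_mono) auto
    then show ?thesis
      by (simp add: algebra_simps)
  qed
  obtain A' where A': "\<And>r. 0 < r \<Longrightarrow> integrable lborel (\<lambda>u. S u * heat_dipole e r u)"
    "\<And>r. 0 < r \<Longrightarrow> \<bar>\<integral>u. S u * heat_dipole e r u \<partial>lborel\<bar> \<le> A' * (r powr ((s - 1) / 2) + 1)"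
  proof (rule heat_dipole_weighted_integral_bound[OF e _ S_le _ _ s0])
    show "integrable lborel (\<lambda>u. (\<bar>E\<bar> + v) * \<psi> u)"
      using \<psi>(1) by simp
  qed (use v C \<psi> in auto)
  have pair: "(\<integral>x. g x * of_real (heat_dipole e r (x - p)) \<partial>lborel) =
      of_real (v * f p * (\<integral>u. indicator (ball 0 a) (p + u) * heat_dipole e r u \<partial>lborel) +
        (\<integral>u. S u * heat_dipole e r u \<partial>lborel))" if r: "0 < r" for r
  proof -
    let ?I = "\<lambda>u. indicator (ball 0 a) (p + u) * heat_dipole e r u"
    have I: "integrable lborel ?I"
      by (rule Bochner_Integration.integrable_bound[OF integrable_heat_dipole[OF e r]])
        (auto simp: indicator_def)
    have "(\<integral>x. g x * of_real (heat_dipole e r (x - p)) \<partial>lborel) =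
        (\<integral>x. complex_of_real ((E + v * indicator (ball 0 a) x) * f x * heat_dipole e r (x - p)) \<partial>lborel)"
      using eq by (intro integral_cong_AE) (measurable, auto)
    also have "\<dots> = of_real (\<integral>x. (E + v * indicator (ball 0 a) x) * f x * heat_dipole e r (x - p) \<partial>lborel)"
      by (rule integral_complex_of_real)
    also have "(\<integral>x. (E + v * indicator (ball 0 a) x) * f x * heat_dipole e r (x - p) \<partial>lborel) =
        (\<integral>u. (E + v * indicator (ball 0 a) (p + u)) * f (p + u) * heat_dipole e r u \<partial>lborel)"
      by (subst integral_translate[where p = p]) auto
    also have "(\<lambda>u. (E + v * indicator (ball 0 a) (p + u)) * f (p + u) * heat_dipole e r u) =
        (\<lambda>u. v * f p * ?I u + S u * heat_dipole e r u + E * f p * heat_dipole e r u)"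
      by (auto simp: S_def algebra_simps)
    also have "(\<integral>u. v * f p * ?I u + S u * heat_dipole e r u + E * f p * heat_dipole e r u \<partial>lborel) =
        v * f p * integral\<^sup>L lborel ?I + (\<integral>u. S u * heat_dipole e r u \<partial>lborel) + E * f p * integral\<^sup>L lborel (heat_dipole e r)"
      using I A'(1)[OF r] integrable_heat_dipole[OF e r] by simp
    finally show ?thesis
      by (simp add: integral_heat_dipole_eq_0)
  qed
  define b where "b = v * f p * c"
  have b: "0 < b"
    using v p c by (simp add: b_def)
  \<comment> \<open>The comparison multiplied by \<open>r powr (1 / 2)\<close>: the jump becomes the
    constant b, and every exponent on the right is positive, the critical one
    \<open>(s - \<alpha>) / 2\<close> because \<open>\<alpha> < s\<close>.\<close>
  have ineq: "b \<le> A * (r powr ((s - \<alpha>) / 2) + r powr (1 / 2)) + A' * (r powr (s / 2) + r powr (1 / 2))"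
    if r: "0 < r" "r \<le> 1" for r
  proof -
    let ?I = "\<integral>u. indicator (ball 0 a) (p + u) * heat_dipole e r u \<partial>lborel"
    let ?T = "\<integral>u. S u * heat_dipole e r u \<partial>lborel"
    have "b * r powr (- 1 / 2) \<le> v * f p * ?I"
      using mult_left_mono[OF c(2)[OF r], of "v * f p"] v p by (simp add: b_def mult.assoc)
    also have "v * f p * ?I \<le> \<bar>v * f p * ?I + ?T\<bar> + \<bar>?T\<bar>"
      by linarith
    also have "\<bar>v * f p * ?I + ?T\<bar> \<le> A * (r powr ((s - 1 - \<alpha>) / 2) + 1)"
      using A[OF r(1)] unfolding pair[OF r(1)] norm_of_real .
    also have "\<bar>?T\<bar> \<le> A' * (r powr ((s - 1) / 2) + 1)"
      by (rule A'(2)[OF r(1)])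
    finally have "b * r powr (- 1 / 2) * r powr (1 / 2) \<le>
        (A * (r powr ((s - 1 - \<alpha>) / 2) + 1) + A' * (r powr ((s - 1) / 2) + 1)) * r powr (1 / 2)"
      by (intro mult_right_mono) auto
    also have "\<dots> = A * (r powr ((s - 1 - \<alpha>) / 2) * r powr (1 / 2) + r powr (1 / 2)) +
        A' * (r powr ((s - 1) / 2) * r powr (1 / 2) + r powr (1 / 2))"
      by (simp add: algebra_simps)
    also have "r powr ((s - 1 - \<alpha>) / 2) * r powr (1 / 2) = r powr ((s - \<alpha>) / 2)"
      by (simp add: diff_divide_distrib flip: powr_add)
    also have "r powr ((s - 1) / 2) * r powr (1 / 2) = r powr (s / 2)"
      by (simp add: diff_divide_distrib flip: powr_add)
    also have "b * r powr (- 1 / 2) * r powr (1 / 2) = b"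
      using r by (simp add: mult.assoc flip: powr_add)
    finally show ?thesis .
  qed
  have pw: "((\<lambda>r::real. r powr q) \<longlongrightarrow> 0) (at_right 0)" if "0 < q" for q :: real
    using that by real_asymp
  have "((\<lambda>r. A * (r powr ((s - \<alpha>) / 2) + r powr (1 / 2)) + A' * (r powr (s / 2) + r powr (1 / 2)))
      \<longlongrightarrow> A * (0 + 0) + A' * (0 + 0)) (at_right 0)"
    using s \<alpha> by (intro tendsto_intros pw) auto
  moreover have "\<forall>\<^sub>F r in at_right 0. b \<le> A * (r powr ((s - \<alpha>) / 2) + r powr (1 / 2)) + A' * (r powr (s / 2) + r powr (1 / 2))"
    unfolding eventually_at_right_field using ineq by (intro exI[of _ 1]) auto
  ultimately have "b \<le> A * (0 + 0) + A' * (0 + 0)"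
    by (intro tendsto_lowerbound) auto
  with b show False
    by simp
qed

section \<open>Global Taylor bounds from local Hoelder regularity\<close>

lemma abs_le_one_plus_square: "\<bar>x\<bar> \<le> 1 + x\<^sup>2" for x :: real
  using zero_le_power2[of "1 - \<bar>x\<bar>"] zero_le_power2[of x] unfolding power2_diff power2_abs one_power2 by linarith

text \<open>Only square integrability controls \<open>f\<close> far away, hence the tail term \<open>f\<^sup>2\<close>.\<close>

lemma Holder_loc_taylor:
  fixes f :: "'a::euclidean_space \<Rightarrow> real"
  assumes "f \<in> Holder_loc s" "0 \<le> s"
  obtains C where "0 \<le> C" "\<And>u. \<bar>f (p + u) - f p - 0 \<bullet> u\<bar> \<le>
    C * norm u powr s + indicator {u. 1 \<le> norm u} u * (f (p + u))\<^sup>2"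
proof -
  obtain C where C: "\<And>x y. x \<in> cball p 1 \<Longrightarrow> y \<in> cball p 1 \<Longrightarrow> norm (f x - f y) \<le> C * norm (x - y) powr s"
    using assms(1)[unfolded Holder_loc_def mem_Collect_eq, rule_format, OF compact_cball[of p 1]] by blast
  \<comment> \<open>\<open>\<bar>C\<bar>\<close> serves inside the unit ball. Outside it,
    \<open>\<bar>f p\<bar> + 1\<close> covers what \<open>f\<^sup>2\<close> does not, since
    \<open>norm u powr s \<ge> 1\<close> there.\<close>
  let ?C = "\<bar>C\<bar> + \<bar>f p\<bar> + 1"
  show ?thesis
  proof (rule that[of ?C])
    fix u :: 'a
    show "\<bar>f (p + u) - f p - 0 \<bullet> u\<bar> \<le> ?C * norm u powr s + indicator {u. 1 \<le> norm u} u * (f (p + u))\<^sup>2"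
    proof (cases "1 \<le> norm u")
      case False
      then have "\<bar>f (p + u) - f p\<bar> \<le> C * norm u powr s"
        using C[of "p + u" p] by (simp add: dist_norm)
      also have "\<dots> \<le> ?C * norm u powr s"
        by (intro mult_right_mono) auto
      finally show ?thesis
        using False by simp
    next
      case True
      have "\<bar>f (p + u) - f p\<bar> \<le> \<bar>f (p + u)\<bar> + \<bar>f p\<bar>"
        by (rule abs_triangle_ineq4)
      also have "\<dots> \<le> (1 + (f (p + u))\<^sup>2) + \<bar>f p\<bar>"
        by (intro add_right_mono abs_le_one_plus_square)
      also have "\<dots> \<le> ?C * 1 + (f (p + u))\<^sup>2"
        by simp
      also have "?C * 1 \<le> ?C * norm u powr s"
        using True assms(2) by (intro mult_left_mono ge_one_powr_ge_zero) auto
      finally show ?thesis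
        using True by simp
    qed
  qed simp
qed

text \<open>The mean value theorem along the segment from p to \<open>p + u\<close>, applied after
  subtracting the linear part: the remainder is an increment of the gradient over a distance at most
  \<open>norm u\<close>, paired with u, hence of order \<open>(s - 1) + 1\<close>.\<close>

lemma C1_Holder_loc_taylor:
  fixes f :: "'a::euclidean_space \<Rightarrow> real"
  assumes "f \<in> C1_Holder_loc (s - 1)" "1 < s"
  obtains C l where "0 \<le> C" "\<And>u. \<bar>f (p + u) - f p - l \<bullet> u\<bar> \<le>
    C * norm u powr s + indicator {u. 1 \<le> norm u} u * (f (p + u))\<^sup>2"
proof -
  obtain g where g: "\<And>x. GDERIV f x :> g x" "g \<in> Holder_loc (s - 1)"
    using assms unfolding C1_Holder_loc_def by blast
  obtain C where C: "\<And>x y. x \<in> cball p 1 \<Longrightarrow> y \<in> cball p 1 \<Longrightarrow> norm (g x - g y) \<le> C * norm (x - y) powr (s - 1)"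
    using g(2)[unfolded Holder_loc_def mem_Collect_eq, rule_format, OF compact_cball[of p 1]] by blast
  let ?l = "g p"
  \<comment> \<open>The extra \<open>norm ?l\<close> covers the linear part outside the unit ball,
    where \<open>norm u \<le> norm u powr s\<close> because \<open>1 < s\<close>.\<close>
  let ?C = "\<bar>C\<bar> + \<bar>f p\<bar> + 1 + norm ?l"
  show ?thesis
  proof (rule that[of ?C ?l])
    fix u :: 'a
    show "\<bar>f (p + u) - f p - ?l \<bullet> u\<bar> \<le> ?C * norm u powr s + indicator {u. 1 \<le> norm u} u * (f (p + u))\<^sup>2"
    proof (cases "1 \<le> norm u")
      case False
      let ?h = "\<lambda>t. f (p + t *\<^sub>R u) - t * (?l \<bullet> u)"
      have der: "(?h has_real_derivative (g (p + t *\<^sub>R u) - ?l) \<bullet> u) (at t)" for t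
      proof -
        have "(f has_derivative (\<lambda>h. h \<bullet> g (p + t *\<^sub>R u))) (at (p + t *\<^sub>R u))"
          using g(1)[of "p + t *\<^sub>R u"] unfolding gderiv_def .
        then have "((\<lambda>t. f (p + t *\<^sub>R u)) has_derivative (\<lambda>h. (h *\<^sub>R u) \<bullet> g (p + t *\<^sub>R u))) (at t)"
          by (rule has_derivative_compose[rotated]) (auto intro!: derivative_eq_intros)
        then have "(?h has_derivative (\<lambda>h. (h *\<^sub>R u) \<bullet> g (p + t *\<^sub>R u) - h * (?l \<bullet> u))) (at t)"
          by (auto intro!: derivative_eq_intros)
        moreover have "(\<lambda>h. (h *\<^sub>R u) \<bullet> g (p + t *\<^sub>R u) - h * (?l \<bullet> u)) = (*) ((g (p + t *\<^sub>R u) - ?l) \<bullet> u)"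
          by (auto simp: fun_eq_iff inner_diff_left inner_diff_right inner_commute right_diff_distrib left_diff_distrib mult.commute)
        ultimately show ?thesis
          unfolding has_field_derivative_def by (simp only:)
      qed
      obtain t where t: "0 < t" "t < 1" "?h 1 - ?h 0 = (1 - 0) * ((g (p + t *\<^sub>R u) - ?l) \<bullet> u)"
        using MVT2[of 0 1 ?h "\<lambda>t. (g (p + t *\<^sub>R u) - ?l) \<bullet> u"] der by auto
      have tu: "norm (t *\<^sub>R u) \<le> norm u"
        using t mult_left_le_one_le[of "norm u" t] by simp
      have "\<bar>f (p + u) - f p - ?l \<bullet> u\<bar> = \<bar>(g (p + t *\<^sub>R u) - ?l) \<bullet> u\<bar>"
        using t by (simp add: algebra_simps)
      also have "\<dots> \<le> norm (g (p + t *\<^sub>R u) - ?l) * norm u"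
        by (rule Cauchy_Schwarz_ineq2)
      also have "\<dots> \<le> (\<bar>C\<bar> * norm u powr (s - 1)) * norm u"
      proof (rule mult_right_mono)
        have "norm (g (p + t *\<^sub>R u) - ?l) \<le> C * norm (t *\<^sub>R u) powr (s - 1)"
          using C[of "p + t *\<^sub>R u" p] False tu by (simp add: dist_norm)
        also have "\<dots> \<le> \<bar>C\<bar> * norm u powr (s - 1)"
          using tu assms(2) by (intro mult_mono powr_mono2) auto
        finally show "norm (g (p + t *\<^sub>R u) - ?l) \<le> \<bar>C\<bar> * norm u powr (s - 1)" .
      qed simp
      also have "\<dots> = \<bar>C\<bar> * (norm u powr (s - 1) * norm u powr 1)"
        by simp
      also have "norm u powr (s - 1) * norm u powr 1 = norm u powr s"
        by (simp only: powr_add[symmetric]) simp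
      also have "\<bar>C\<bar> * norm u powr s \<le> ?C * norm u powr s"
        by (intro mult_right_mono) auto
      finally show ?thesis
        using False by simp
    next
      case True
      have "\<bar>f (p + u) - f p - ?l \<bullet> u\<bar> \<le> (\<bar>f (p + u)\<bar> + \<bar>f p\<bar>) + \<bar>?l \<bullet> u\<bar>"
        by (intro order_trans[OF abs_triangle_ineq4] add_right_mono abs_triangle_ineq4)
      also have "\<dots> \<le> ((1 + (f (p + u))\<^sup>2) + \<bar>f p\<bar>) + norm ?l * norm u"
        by (intro add_mono abs_le_one_plus_square Cauchy_Schwarz_ineq2 order_refl)
      also have "\<dots> \<le> (\<bar>C\<bar> + \<bar>f p\<bar> + 1) * 1 + norm ?l * norm u + (f (p + u))\<^sup>2"
        by simp
      also have "(\<bar>C\<bar> + \<bar>f p\<bar> + 1) * 1 \<le> (\<bar>C\<bar> + \<bar>f p\<bar> + 1) * norm u powr s"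
        using True assms(2) by (intro mult_left_mono ge_one_powr_ge_zero) auto
      also have "norm ?l * norm u \<le> norm ?l * norm u powr s"
        using True assms(2) powr_mono[of 1 s "norm u"] by (intro mult_left_mono) auto
      finally show ?thesis
        using True by (simp add: distrib_right)
    qed
  qed simp
qed

theorem theorem5p2:
  fixes m \<alpha> a v :: real
    and \<phi>\<^sub>0 :: "real ^ 'd \<Rightarrow> real"
  assumes "0 < \<alpha>" and "\<alpha> < 2" and "0 \<le> m" and "0 < a" and "0 < v"
    and "ground_state m \<alpha> a v (\<lambda>x. complex_of_real (\<phi>\<^sub>0 x))"
    and "\<forall>x. 0 < \<phi>\<^sub>0 x"
    and "L2_norm (\<lambda>x. complex_of_real (\<phi>\<^sub>0 x)) = 1"
  shows "(\<alpha> \<in> {0<..<1} \<longrightarrow> (\<forall>\<delta>\<in>{0<..<1 - \<alpha>}. \<phi>\<^sub>0 \<notin> Holder_loc (\<alpha> + \<delta>))) \<and>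
         (\<alpha> \<in> {1..<2} \<longrightarrow> (\<forall>\<delta>\<in>{0<..<2 - \<alpha>}. \<phi>\<^sub>0 \<notin> C1_Holder_loc (\<alpha> + \<delta> - 1)))"
proof -
  obtain e :: "real ^ 'd" where e: "e \<in> Basis"
    using nonempty_Basis by blast
  define E where "E = spectral_bottom (H_op m \<alpha> a v :: (real ^ 'd) L2_op)"
  \<comment> \<open>The boundary point at which e points into the ball, so that the jump pairs
    positively with the dipole.\<close>
  define p where "p = - (a *\<^sub>R e)"
  have "(\<lambda>x. complex_of_real (\<phi>\<^sub>0 x), \<lambda>x. of_real E * of_real (\<phi>\<^sub>0 x)) \<in> H_op m \<alpha> a v"
    using assms(6) unfolding ground_state_def E_def Let_def by blast
  then obtain g where fg: "(\<lambda>x. complex_of_real (\<phi>\<^sub>0 x), g) \<in> fourier_multiplier (\<lambda>y. Phi m \<alpha> ((norm y)\<^sup>2))"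
    and "AE x in lborel. of_real E * complex_of_real (\<phi>\<^sub>0 x) =
      g x + of_real (- v * indicator (ball 0 a) x) * of_real (\<phi>\<^sub>0 x)"
    by (auto simp: H_op_def add_potential_def L_op_def)
  from this(2) have eq: "AE x in lborel. g x = of_real ((E + v * indicator (ball 0 a) x) * \<phi>\<^sub>0 x)"
    by eventually_elim (simp add: algebra_simps)
  have "(\<lambda>x. complex_of_real (\<phi>\<^sub>0 x)) \<in> L2_space"
    using fg by (auto simp: fourier_multiplier_def plancherel_def)
  then have "(\<lambda>x. complex_of_real (\<phi>\<^sub>0 x)) \<in> borel_measurable borel"
    and sq: "integrable lborel (\<lambda>x. (\<phi>\<^sub>0 x)\<^sup>2)"
    by (auto simp: L2_space_def)
  from measurable_compose[OF this(1) borel_measurable_Re] have \<phi> [measurable]: "\<phi>\<^sub>0 \<in> borel_measurable borel"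
    by simp
  \<comment> \<open>The integrable majorant for the region outside the unit ball, common to both
    cases.\<close>
  have tail: "integrable lborel (\<lambda>u. (\<phi>\<^sub>0 (p + u))\<^sup>2)"
    using integrable_translate[OF sq] .
  have no_taylor: False
    if "\<And>u. \<bar>\<phi>\<^sub>0 (p + u) - \<phi>\<^sub>0 p - l \<bullet> u\<bar> \<le> C * norm u powr s + indicator {u. 1 \<le> norm u} u * (\<phi>\<^sub>0 (p + u))\<^sup>2"
      and "0 \<le> C" "\<alpha> < s" "s < 1 + \<alpha>" for l C s
    using potential_well_no_taylor_expansion[OF fg eq assms(1-3) e assms(4,5) \<phi> sq p_def _ that(1,2) tail _ that(3,4)]
      assms(7) by simp
  show ?thesis
  proof (intro conjI impI ballI notI)
    fix \<delta> assume "\<alpha> \<in> {0<..<1}" "\<delta> \<in> {0<..<1 - \<alpha>}" and H: "\<phi>\<^sub>0 \<in> Holder_loc (\<alpha> + \<delta>)"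
    then have \<delta>: "0 \<le> \<alpha> + \<delta>" "\<alpha> < \<alpha> + \<delta>" "\<alpha> + \<delta> < 1 + \<alpha>"
      by auto
    show False
      by (rule Holder_loc_taylor[OF H \<delta>(1), of p]) (rule no_taylor[OF _ _ \<delta>(2,3)])
  next
    fix \<delta> assume "\<alpha> \<in> {1..<2}" "\<delta> \<in> {0<..<2 - \<alpha>}" and H: "\<phi>\<^sub>0 \<in> C1_Holder_loc (\<alpha> + \<delta> - 1)"
    \<comment> \<open>The upper bound is \<open>\<delta> < 1\<close>, which follows here from
      \<open>\<delta> < 2 - \<alpha>\<close> and \<open>1 \<le> \<alpha>\<close>.\<close>
    then have \<delta>: "1 < \<alpha> + \<delta>" "\<alpha> < \<alpha> + \<delta>" "\<alpha> + \<delta> < 1 + \<alpha>"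
      by auto
    show False
      by (rule C1_Holder_loc_taylor[OF H \<delta>(1), of p]) (rule no_taylor[OF _ _ \<delta>(2,3)])
  qed
qed

end
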